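(* Let $p$ be a prime, let $\bar S$ be a free pro-$p$ group and let $n\geq 1$. Then $\bar S_n=\bigcap_\rho \operatorname{Ker}(\rho)$, where $\rho$ ranges over all continuous homomorphisms (linear representations) $\rho\colon \bar S\to \mathrm{GL}_n(\mathbb{F}_p)$.
   Context: For a profinite group $G$, the $p$-Zassenhaus filtration $(G_n)_{n\geq1}$ is defined by $G_1=G$ and $G_n=G_{\lceil n/p\rceil}^p\prod_{i+j=n}[G_i,G_j]$ for $n\geq2$, where for closed subgroups $H,K$, $[H,K]$ (resp. $H^p$) is the closed subgroup generated by all commutators $[\sigma,\tau]$, $\sigma\in H,\tau\in K$ (resp. all $p$-th powers $\sigma^p$, $\sigma\in H$). Equivalently, it is the fastest descending sequence of closed subgroups with $G_1=G$, $G_i^p\leq G_{ip}$ and $[G_i,G_j]\leq G_{i+j}$. $\mathrm{GL}_n(\mathbb{F}_p)$ carries the discrete topology. *)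

theory Defs
  imports
    "HOL-Analysis.Analysis"
    "HOL-Algebra.Coset"
    "Jordan_Normal_Form.Matrix"
    "Berlekamp_Zassenhaus.Finite_Field"
begin

definition topological_group :: "('a, 'm) monoid_scheme \<Rightarrow> 'a topology \<Rightarrow> bool" where
  "topological_group G T \<longleftrightarrow>
     group G \<and> topspace T = carrier G \<and>
     continuous_map (prod_topology T T) T (\<lambda>(x, y). x \<otimes>\<^bsub>G\<^esub> y) \<and>
     continuous_map T T (\<lambda>x. inv\<^bsub>G\<^esub> x)"

definition totally_disconnected_space :: "'a topology \<Rightarrow> bool" where
  "totally_disconnected_space T \<longleftrightarrow>
     (\<forall>C. connectedin T C \<longrightarrow> (\<forall>x\<in>C. \<forall>y\<in>C. x = y))"

definition profinite_group :: "('a, 'm) monoid_scheme \<Rightarrow> 'a topology \<Rightarrow> bool" where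
  "profinite_group G T \<longleftrightarrow>
     topological_group G T \<and> compact_space T \<and> Hausdorff_space T \<and>
     totally_disconnected_space T"

definition pro_p_group :: "nat \<Rightarrow> ('a, 'm) monoid_scheme \<Rightarrow> 'a topology \<Rightarrow> bool" where
  "pro_p_group p G T \<longleftrightarrow>
     profinite_group G T \<and>
     (\<forall>N. N \<lhd> G \<and> openin T N \<longrightarrow> (\<exists>k. card (rcosets\<^bsub>G\<^esub> N) = p ^ k))"

definition continuous_hom ::
  "('a, 'm) monoid_scheme \<Rightarrow> 'a topology \<Rightarrow> ('b, 'k) monoid_scheme \<Rightarrow> 'b topology \<Rightarrow> ('a \<Rightarrow> 'b) set"
  where "continuous_hom G T H U = {f \<in> hom G H. continuous_map T U f}"

definition closed_subgroup_generated ::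
  "('a, 'm) monoid_scheme \<Rightarrow> 'a topology \<Rightarrow> 'a set \<Rightarrow> 'a set"
  where "closed_subgroup_generated G T A = (\<lambda>H. subgroup H G \<and> closedin T H) hull A"

definition converges_to_one ::
  "('b, 'k) monoid_scheme \<Rightarrow> 'b topology \<Rightarrow> 'a set \<Rightarrow> ('a \<Rightarrow> 'b) \<Rightarrow> bool"
  where "converges_to_one H U X \<phi> \<longleftrightarrow>
     (\<forall>V. openin U V \<and> \<one>\<^bsub>H\<^esub> \<in> V \<longrightarrow> finite {x \<in> X. \<phi> x \<notin> V})"

text \<open>
  A definition cannot quantify over types, so the universal property below ranges over the
  pro-\<open>p\<close> groups whose elements form a set of type \<open>'a + nat\<close>. This is no restriction. A
  continuous homomorphism into a pro-\<open>p\<close> group \<open>H\<close> is a compatible family of continuous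
  homomorphisms into the finite quotients of \<open>H\<close>, and every finite group has an isomorphic
  copy in \<open>nat\<close>. So the property for the type \<open>'a + nat\<close> implies it for all types. The
  homomorphism \<open>f\<close> is taken extensional because only its values on \<open>carrier S\<close> are meaningful.
\<close>

definition free_pro_p_group_on ::
  "nat \<Rightarrow> 'a set \<Rightarrow> ('a, 'm) monoid_scheme \<Rightarrow> 'a topology \<Rightarrow> bool" where
  "free_pro_p_group_on p X S T \<longleftrightarrow>
     pro_p_group p S T \<and>
     X \<subseteq> carrier S \<and>
     converges_to_one S T X (\<lambda>x. x) \<and>
     closed_subgroup_generated S T X = carrier S \<and>
     (\<forall>(H :: ('a + nat) monoid) U \<phi>.
        pro_p_group p H U \<and> \<phi> \<in> X \<rightarrow> carrier H \<and> converges_to_one H U X \<phi> \<longrightarrow>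
        (\<exists>!f. f \<in> continuous_hom S T H U \<and> f \<in> extensional (carrier S) \<and>
              (\<forall>x\<in>X. f x = \<phi> x)))"

definition free_pro_p_group :: "nat \<Rightarrow> ('a, 'm) monoid_scheme \<Rightarrow> 'a topology \<Rightarrow> bool" where
  "free_pro_p_group p S T \<longleftrightarrow> (\<exists>X. free_pro_p_group_on p X S T)"

definition closed_power ::
  "('a, 'm) monoid_scheme \<Rightarrow> 'a topology \<Rightarrow> 'a set \<Rightarrow> nat \<Rightarrow> 'a set" where
  "closed_power G T H p = closed_subgroup_generated G T {\<sigma> [^]\<^bsub>G\<^esub> p | \<sigma>. \<sigma> \<in> H}"

definition closed_commutator ::
  "('a, 'm) monoid_scheme \<Rightarrow> 'a topology \<Rightarrow> 'a set \<Rightarrow> 'a set \<Rightarrow> 'a set" where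
  "closed_commutator G T H K = closed_subgroup_generated G T
     {inv\<^bsub>G\<^esub> \<sigma> \<otimes>\<^bsub>G\<^esub> inv\<^bsub>G\<^esub> \<tau> \<otimes>\<^bsub>G\<^esub> \<sigma> \<otimes>\<^bsub>G\<^esub> \<tau> | \<sigma> \<tau>. \<sigma> \<in> H \<and> \<tau> \<in> K}"

text \<open>
  The index \<open>n = 0\<close> and the values \<open>p < 2\<close> are junk cases, needed only to make the recursion
  total. The product over \<open>i + j = n\<close> (with \<open>i, j \<ge> 1\<close>) is the product of subsets of \<open>G\<close>, taken
  in the order \<open>i = 1, \<dots>, n - 1\<close>; the factors are normal subgroups, so the order is immaterial.
\<close>

function zassenhaus ::
  "nat \<Rightarrow> ('a, 'm) monoid_scheme \<Rightarrow> 'a topology \<Rightarrow> nat \<Rightarrow> 'a set" where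
  "zassenhaus p G T n =
     (if n < 2 \<or> p < 2 then carrier G
      else closed_power G T (zassenhaus p G T (nat \<lceil>real n / real p\<rceil>)) p <#>\<^bsub>G\<^esub>
           foldr (\<lambda>i A. closed_commutator G T (zassenhaus p G T i) (zassenhaus p G T (n - i))
                          <#>\<^bsub>G\<^esub> A)
             [1..<n] {\<one>\<^bsub>G\<^esub>})"
  by pat_completeness auto
termination
proof (relation "Wellfounded.measure (\<lambda>(p, G, T, n). n)", goal_cases)
  case (2 p G T n)
  then have "p \<ge> 2" and "n \<ge> 2"
    by auto
  have "real n / real p \<le> real n / 2"
    by (intro divide_left_mono) (use \<open>p \<ge> 2\<close> in auto)
  with \<open>n \<ge> 2\<close> have "real n / real p \<le> real (n - 1)"
    by linarith
  then have "\<lceil>real n / real p\<rceil> \<le> int (n - 1)"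
    by (simp add: ceiling_le_iff)
  with \<open>n \<ge> 2\<close> show ?case
    by simp
qed auto

declare zassenhaus.simps [simp del]

definition GL :: "nat \<Rightarrow> 'f::field mat monoid" where
  "GL n = units_of (ring_mat TYPE('f) n ())"

end

theory Submission
  imports Defs "Jordan_Normal_Form.Determinant" "HOL-Algebra.Group_Action" "HOL-Library.Function_Algebras"
begin

text \<open>
  The inclusion of the filtration in the kernels holds because the image of a representation is a
  finite \<open>p\<close>-group in characteristic \<open>p\<close>: counting fixed points yields a flag of length \<open>n\<close> on which
  the group acts unipotently, and the elements that lower the flag by \<open>i\<close> steps form a filtration
  with the defining properties of the Zassenhaus filtration that is trivial at \<open>i = n\<close>.

  For the converse let \<open>s\<close> lie outside the \<open>n\<close>-th term. A dual form of Jennings' theorem gives a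
  locally constant function \<open>f\<close> with \<open>f s \<noteq> f 1\<close> that is annihilated by all \<open>n\<close>-fold differences.
  If \<open>s\<close> is congruent to the word \<open>x\<^sub>1 \<cdots> x\<^sub>m\<close> in free generators modulo a small open subgroup, then
  \<open>f s\<close> is the sum over all subsequences \<open>u\<close> of this word of the differences of \<open>f\<close> at \<open>1\<close> along \<open>u\<close>,
  and only lengths below \<open>n\<close> contribute. The multiplicity of \<open>u\<close> among the subsequences is, modulo
  \<open>p\<close>, a matrix entry at \<open>s\<close> of the unitriangular representation that sends each generator \<open>x\<close> to the
  identity plus ones at the places \<open>(i, i + 1)\<close> with \<open>u\<^sub>i = x\<close>. If all representations were trivial
  at \<open>s\<close>, then all these multiplicities with \<open>u\<close> nonempty would vanish, so that \<open>f s = f 1\<close>.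
\<close>

section \<open>Polynomial functions on a filtered group\<close>

text \<open>A function killed by all \<open>n\<close>-fold differences is, dually, a functional on a
  group algebra vanishing on the \<open>n\<close>-th power of the augmentation ideal.

  Weights are what lets the induction close. Extending a function across a step of index
  \<open>p\<close> and weight \<open>w\<close> wraps the coordinate from \<open>p - 1\<close> to 0
  and leaves a carry, a \<open>p\<close>-th power. Counting differences alone could not absorb it;
  but the carry has weight \<open>p * w\<close>, so a difference along it gains enough to pay for
  the coordinate function of degree \<open>(p - 1) * w\<close> that isolates the wrap.

  Functions are never passed to a quotient: for \<open>N\<close> open and normal, the terms
  \<open>Z i\<close> times \<open>N\<close> form a series in the free group itself, and the degree
  bound \<open>n\<close> already forces invariance under \<open>N\<close>.

  The choices in the converse have a forced order: \<open>N\<close> and \<open>f\<close>, then the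
  finitely many generators outside \<open>N\<close>, then the words of length below \<open>n\<close>
  over them with their representations, then an open \<open>K\<close> inside \<open>N\<close> and
  all their kernels, and last the word approximating \<open>s\<close> modulo \<open>K\<close>. As
  that word depends on the representations, these are indexed by the possible subsequences
  \<open>u\<close>, not by the word.\<close>

lemma (in group) mult_inv_cancel:
  "\<lbrakk>x \<in> carrier G; y \<in> carrier G\<rbrakk> \<Longrightarrow> x \<otimes> (inv x \<otimes> y) = y"
  "\<lbrakk>x \<in> carrier G; y \<in> carrier G\<rbrakk> \<Longrightarrow> inv x \<otimes> (x \<otimes> y) = y"
  by (simp_all flip: m_assoc)

text \<open>A restricted central series in the sense of Lazard, with weights starting at 1. It need
  not reach the trivial group: in the application every term contains a fixed open normal
  subgroup.\<close>

locale restricted_series = group G for G (structure) +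
  fixes P :: "nat \<Rightarrow> 'a set" and p :: nat
  assumes prime_p: "prime p"
    and subgroup_series: "subgroup (P i) G"
    and series_1: "P (Suc 0) = carrier G"
    and series_Suc: "i > 0 \<Longrightarrow> P (Suc i) \<subseteq> P i"
    and series_comm: "\<lbrakk>i > 0; j > 0; x \<in> P i; y \<in> P j\<rbrakk>
          \<Longrightarrow> inv x \<otimes> inv y \<otimes> x \<otimes> y \<in> P (i + j)"
    and series_pow: "\<lbrakk>i > 0; x \<in> P i\<rbrakk> \<Longrightarrow> x [^] p \<in> P (i * p)"
begin

lemma series_closed [simp]: "x \<in> P i \<Longrightarrow> x \<in> carrier G"
  using subgroup.subset[OF subgroup_series] by blast

lemma series_antimono:
  assumes "0 < i" "i \<le> j" shows "P j \<subseteq> P i"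
  using assms(2,1)
proof (induction j rule: dec_induct)
  case (step j)
  then show ?case using series_Suc[of j] by auto
qed auto

text \<open>Since \<open>P 1\<close> is the whole group, \<open>x\<close> and its conjugate differ
  by a commutator in \<open>P (i + 1)\<close>.\<close>

lemma series_conj:
  assumes "i > 0" "x \<in> P i" "y \<in> carrier G"
  shows "inv y \<otimes> x \<otimes> y \<in> P i"
proof -
  have x: "x \<in> carrier G" using assms(2) by simp
  have "inv x \<otimes> inv y \<otimes> x \<otimes> y \<in> P (i + 1)"
    using series_comm[of i 1 x y] assms series_1 by simp
  then have "inv x \<otimes> inv y \<otimes> x \<otimes> y \<in> P i"
    using series_antimono[of i "i+1"] assms(1) by auto
  then have "x \<otimes> (inv x \<otimes> inv y \<otimes> x \<otimes> y) \<in> P i"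
    by (rule subgroup.m_closed[OF subgroup_series assms(2)])
  also have "x \<otimes> (inv x \<otimes> inv y \<otimes> x \<otimes> y) = inv y \<otimes> x \<otimes> y"
    using assms(3) x by (simp add: m_assoc mult_inv_cancel)
  finally show ?thesis .
qed

text \<open>
  The functions killed by every composition of right differences along \<open>P (j\<^sub>1)\<close>, \<dots>, \<open>P (j\<^sub>k)\<close>
  with \<open>j\<^sub>1 + \<dots> + j\<^sub>k \<ge> e\<close>, i.e. polynomial functions of weighted degree below \<open>e\<close>.
\<close>
fun polyn :: "'a set \<Rightarrow> nat \<Rightarrow> ('a \<Rightarrow> 'f::comm_ring_1) \<Rightarrow> bool" where
  "polyn H 0 f \<longleftrightarrow> (\<forall>x\<in>H. f x = 0)"
| "polyn H (Suc e) f \<longleftrightarrow> (\<forall>j h. h \<in> H \<inter> P (Suc j) \<longrightarrow> polyn H (e - j) (\<lambda>x. f (x \<otimes> h) - f x))"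

lemma polynI:
  assumes "e = 0 \<Longrightarrow> \<forall>x\<in>H. f x = 0"
    and "\<And>j h. \<lbrakk>e > 0; h \<in> H; h \<in> P (Suc j)\<rbrakk> \<Longrightarrow> polyn H (e - Suc j) (\<lambda>x. f (x \<otimes> h) - f x)"
  shows "polyn H e f"
  using assms by (cases e) auto

lemma polynD:
  assumes "polyn H e f" "subgroup H G" "h \<in> H" "h \<in> P (Suc j)"
  shows "polyn H (e - Suc j) (\<lambda>x. f (x \<otimes> h) - f x)"
  using assms by (cases e) (auto simp: subgroup.m_closed)

context
  fixes H :: "'a set"
  assumes H: "subgroup H G"
begin

lemma closed_H [simp]: "x \<in> H \<Longrightarrow> x \<in> carrier G"
  using subgroup.subset[OF H] by blast

lemmas H_simps [simp] = subgroup.m_closed[OF H] subgroup.m_inv_closed[OF H] subgroup.one_closed[OF H]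

lemma polyn_cong:
  assumes "polyn H e f" "\<And>x. x \<in> H \<Longrightarrow> f x = f' x"
  shows "polyn H e f'"
  using assms
proof (induction e arbitrary: f f' rule: less_induct)
  case (less e)
  show ?case
  proof (rule polynI)
    assume "e = 0"
    then show "\<forall>x\<in>H. f' x = 0" using less.prems by auto
  next
    fix j h assume *: "e > 0" "h \<in> H" "h \<in> P (Suc j)"
    show "polyn H (e - Suc j) (\<lambda>x. f' (x \<otimes> h) - f' x)"
      by (rule less.IH[OF _ polynD[OF less.prems(1) H *(2,3)]]) (use * less.prems(2) in auto)
  qed
qed

lemma polyn_zero: "(\<And>x. x \<in> H \<Longrightarrow> f x = 0) \<Longrightarrow> polyn H e f"
proof (induction e arbitrary: f rule: less_induct)
  case (less e)
  show ?case
  proof (rule polynI)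
    fix j h assume "e > 0" "h \<in> H" "h \<in> P (Suc j)"
    then show "polyn H (e - Suc j) (\<lambda>x. f (x \<otimes> h) - f x)"
      using less.prems by (intro less.IH) simp_all
  qed (use less.prems in simp)
qed

lemma polyn_mono:
  assumes "polyn H e f" "e \<le> e'"
  shows "polyn H e' f"
  using assms
proof (induction e' arbitrary: f e rule: less_induct)
  case (less e')
  show ?case
  proof (rule polynI)
    assume "e' = 0"
    then show "\<forall>x\<in>H. f x = 0" using less.prems by auto
  next
    fix j h assume *: "e' > 0" "h \<in> H" "h \<in> P (Suc j)"
    show "polyn H (e' - Suc j) (\<lambda>x. f (x \<otimes> h) - f x)"
      by (rule less.IH[OF _ polynD[OF less.prems(1) H *(2,3)]]) (use * less.prems(2) in auto)
  qed
qed

lemma polyn_add: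
  assumes "polyn H e f" "polyn H e f'"
  shows "polyn H e (\<lambda>x. f x + f' x)"
  using assms
proof (induction e arbitrary: f f' rule: less_induct)
  case (less e)
  show ?case
  proof (rule polynI)
    assume "e = 0"
    then show "\<forall>x\<in>H. f x + f' x = 0" using less.prems by auto
  next
    fix j h assume *: "e > 0" "h \<in> H" "h \<in> P (Suc j)"
    have "polyn H (e - Suc j) (\<lambda>x. (f (x \<otimes> h) - f x) + (f' (x \<otimes> h) - f' x))"
      using * by (intro less.IH polynD[OF less.prems(1) H] polynD[OF less.prems(2) H]) auto
    then show "polyn H (e - Suc j) (\<lambda>x. f (x \<otimes> h) + f' (x \<otimes> h) - (f x + f' x))"
      by (rule polyn_cong) simp
  qed
qed

lemma polyn_translate:
  assumes "polyn H e f" "u \<in> H"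
  shows "polyn H e (\<lambda>x. f (x \<otimes> u))"
proof -
  have "polyn H e (\<lambda>x. f (x \<otimes> u) - f x)"
    by (rule polyn_mono[OF polynD[OF assms(1) H assms(2), of 0]]) (use assms(2) series_1 in auto)
  from polyn_add[OF this assms(1)] show ?thesis by (rule polyn_cong) simp
qed

text \<open>Left and right differences commute, so right differences can be peeled off first. Once
  the bound is exhausted, \<open>h \<otimes> x = x \<otimes> c\<close> with \<open>c\<close> a
  conjugate of \<open>h\<close>, which has the same weight.\<close>

lemma polyn_left:
  assumes "polyn H e f" "h \<in> H" "h \<in> P (Suc j)"
  shows "polyn H (e - Suc j) (\<lambda>x. f (h \<otimes> x) - f x)"
  using assms(1)
proof (induction e arbitrary: f rule: less_induct)
  case (less e)
  show ?case
  proof (rule polynI)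
    assume e: "e - Suc j = 0"
    show "\<forall>x\<in>H. f (h \<otimes> x) - f x = 0"
    proof
      fix x assume x: "x \<in> H"
      define c where "c = inv x \<otimes> h \<otimes> x"
      have c: "c \<in> H" "c \<in> P (Suc j)" "h \<otimes> x = x \<otimes> c"
        using x assms(2,3) series_conj[of "Suc j" h x] by (auto simp: c_def m_assoc mult_inv_cancel)
      show "f (h \<otimes> x) - f x = 0"
        using polynD[OF less.prems H c(1,2)] x e by (simp add: c(3))
    qed
  next
    fix i k assume *: "e - Suc j > 0" "k \<in> H" "k \<in> P (Suc i)"
    let ?D = "\<lambda>x. f (x \<otimes> k) - f x"
    have "polyn H (e - Suc i - Suc j) (\<lambda>x. ?D (h \<otimes> x) - ?D x)"
      by (rule less.IH[OF _ polynD[OF less.prems H *(2,3)]]) (use * in auto)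
    then have "polyn H (e - Suc j - Suc i) (\<lambda>x. ?D (h \<otimes> x) - ?D x)"
      by (simp add: algebra_simps)
    then show "polyn H (e - Suc j - Suc i) (\<lambda>x. f (h \<otimes> (x \<otimes> k)) - f (x \<otimes> k) - (f (h \<otimes> x) - f x))"
      by (rule polyn_cong) (use * assms(2) in \<open>simp add: m_assoc\<close>)
  qed
qed

context
  fixes g
  assumes g: "g \<in> carrier G" and normalizes: "\<And>x. x \<in> H \<Longrightarrow> inv g \<otimes> x \<otimes> g \<in> H"
begin

lemma polyn_conj:
  assumes "polyn H e f"
  shows "polyn H e (\<lambda>x. f (inv g \<otimes> x \<otimes> g))"
  using assms
proof (induction e arbitrary: f rule: less_induct)
  case (less e)
  show ?case
  proof (rule polynI)
    assume "e = 0"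
    then show "\<forall>x\<in>H. f (inv g \<otimes> x \<otimes> g) = 0" using less.prems normalizes by auto
  next
    fix j k assume *: "e > 0" "k \<in> H" "k \<in> P (Suc j)"
    define k' where "k' = inv g \<otimes> k \<otimes> g"
    have k': "k' \<in> H" "k' \<in> P (Suc j)"
      using * g normalizes series_conj by (auto simp: k'_def)
    have "polyn H (e - Suc j) (\<lambda>x. f (inv g \<otimes> x \<otimes> g \<otimes> k') - f (inv g \<otimes> x \<otimes> g))"
      by (rule less.IH[OF _ polynD[OF less.prems H k']]) (use * in auto)
    then show "polyn H (e - Suc j) (\<lambda>x. f (inv g \<otimes> (x \<otimes> k) \<otimes> g) - f (inv g \<otimes> x \<otimes> g))"
      by (rule polyn_cong) (use * g in \<open>simp add: k'_def m_assoc mult_inv_cancel\<close>)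
  qed
qed

text \<open>Conjugation by \<open>g\<close> multiplies an increment \<open>k\<close> of weight
  \<open>j\<close> by a commutator of weight \<open>j + w\<close>, so it perturbs \<open>f\<close>
  only in degree lower by \<open>w\<close>. For a bound at most \<open>w\<close> even the values
  agree: \<open>x\<close> has weight 1, and its conjugate is \<open>x\<close> times an element of
  weight \<open>w + 1\<close>.\<close>

lemma polyn_conj_diff:
  assumes "polyn H e f" "w > 0" "g \<in> P w"
  shows "polyn H (e - w) (\<lambda>x. f (inv g \<otimes> x \<otimes> g) - f x)"
  using assms(1)
proof (induction e arbitrary: f rule: less_induct)
  case (less e)
  have comm: "\<exists>c \<in> H \<inter> P (Suc j + w). inv g \<otimes> k \<otimes> g = k \<otimes> c"
    if "k \<in> H" "k \<in> P (Suc j)" for k j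
  proof
    let ?c = "inv k \<otimes> inv g \<otimes> k \<otimes> g"
    have "inv k \<otimes> (inv g \<otimes> k \<otimes> g) \<in> H"
      using that normalizes by simp
    then show "?c \<in> H \<inter> P (Suc j + w)"
      using that g series_comm[of "Suc j" w k g] assms by (simp add: m_assoc)
    show "inv g \<otimes> k \<otimes> g = k \<otimes> ?c"
      using that g by (simp add: m_assoc mult_inv_cancel)
  qed
  show ?case
  proof (rule polynI)
    assume e: "e - w = 0"
    show "\<forall>x\<in>H. f (inv g \<otimes> x \<otimes> g) - f x = 0"
    proof
      fix x assume x: "x \<in> H"
      then obtain c where c: "c \<in> H" "c \<in> P (Suc w)" "inv g \<otimes> x \<otimes> g = x \<otimes> c"
        using comm[of x 0] series_1 by auto
      show "f (inv g \<otimes> x \<otimes> g) - f x = 0"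
        using polynD[OF less.prems H c(1,2)] x e by (simp add: c(3))
    qed
  next
    fix j k assume *: "e - w > 0" "k \<in> H" "k \<in> P (Suc j)"
    obtain c where c: "c \<in> H" "c \<in> P (Suc (j + w))" "inv g \<otimes> k \<otimes> g = k \<otimes> c"
      using comm[OF *(2,3)] by auto
    have kc: "k \<otimes> c \<in> H" "k \<otimes> c \<in> P (Suc j)"
      using * g normalizes[of k] series_conj[of "Suc j" k g] c by auto
    let ?D = "\<lambda>x. f (x \<otimes> (k \<otimes> c)) - f x"
    have 1: "polyn H (e - Suc j - w) (\<lambda>x. ?D (inv g \<otimes> x \<otimes> g) - ?D x)"
      by (rule less.IH[OF _ polynD[OF less.prems H kc]]) (use * in auto)
    have 2: "polyn H (e - Suc j - w) (\<lambda>x. f (x \<otimes> k \<otimes> c) - f (x \<otimes> k))"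
      using polyn_translate[OF polynD[OF less.prems H c(1,2)] *(2)] by simp
    \<comment> \<open>The terms \<open>f (x \<otimes> k \<otimes> c)\<close> cancel, and
      \<open>k \<otimes> c\<close> is the conjugate of \<open>k\<close>; so the sum is the right
      difference along \<open>k\<close> of
      \<open>f (inv g \<otimes> x \<otimes> g) - f x\<close>.\<close>
    have 3: "polyn H (e - w - Suc j)
        (\<lambda>x. ?D (inv g \<otimes> x \<otimes> g) - ?D x + (f (x \<otimes> k \<otimes> c) - f (x \<otimes> k)))"
      using polyn_add[OF 1 2] by (simp add: algebra_simps)
    have 4: "inv g \<otimes> x \<otimes> g \<otimes> (k \<otimes> c) = inv g \<otimes> (x \<otimes> k) \<otimes> g" if "x \<in> H" for x
      using that g * by (simp add: m_assoc mult_inv_cancel flip: c(3))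
    show "polyn H (e - w - Suc j)
        (\<lambda>x. f (inv g \<otimes> (x \<otimes> k) \<otimes> g) - f (x \<otimes> k) - (f (inv g \<otimes> x \<otimes> g) - f x))"
      by (rule polyn_cong[OF 3]) (use * c in \<open>simp add: 4\<close>, simp add: m_assoc)
  qed
qed

end

end

declare closed_H [simp del] H_simps [simp del]

end

text \<open>One step of index \<open>p\<close> inside the layer between \<open>P w\<close> and
  \<open>P (Suc w)\<close>. Each element of \<open>H\<close> is \<open>g [^] a \<otimes> m\<close>
  with a digit \<open>a < p\<close>, unique because \<open>g\<close> is outside \<open>M\<close> and
  \<open>p\<close> is prime. The digit is a coordinate of weight \<open>w\<close>.\<close>

locale series_layer = restricted_series +
  fixes H M :: "'a set" and g :: 'a and w :: nat
  assumes subgroup_H: "subgroup H G" and subgroup_M: "subgroup M G" and M_H: "M \<subseteq> H"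
    and w_pos: "w > 0" and H_series: "H \<subseteq> P w" and series_M: "H \<inter> P (Suc w) \<subseteq> M"
    and g_H: "g \<in> H" and g_M: "g \<notin> M"
    and g_normalizes: "\<And>x. x \<in> M \<Longrightarrow> inv g \<otimes> x \<otimes> g \<in> M"
    and g_pow: "g [^] p \<in> M"
    and decompose: "\<And>x. x \<in> H \<Longrightarrow> \<exists>a<p. \<exists>m\<in>M. x = g [^] a \<otimes> m"
begin

lemmas M_simps [simp] =
  closed_H[OF subgroup_M] subgroup.m_closed[OF subgroup_M]
  subgroup.m_inv_closed[OF subgroup_M] subgroup.one_closed[OF subgroup_M]

lemmas layer_H_simps [simp] =
  closed_H[OF subgroup_H] subgroup.m_closed[OF subgroup_H]
  subgroup.m_inv_closed[OF subgroup_H] subgroup.one_closed[OF subgroup_H]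

lemma M_in_H [simp]: "x \<in> M \<Longrightarrow> x \<in> H"
  using M_H by auto

lemma g_closed [simp]: "g \<in> carrier G"
  using g_H by simp

lemma g_pow_H [simp]: "g [^] (a::nat) \<in> H"
  by (induction a) (use g_H in auto)

lemma pow_M [simp]: "x \<in> M \<Longrightarrow> x [^] (a::nat) \<in> M"
  by (induction a) auto

lemma g_pow_M:
  assumes "g [^] (d::nat) \<in> M" "d < p"
  shows "d = 0"
proof (rule ccontr)
  assume "d \<noteq> 0"
  then have "coprime d p"
    using prime_imp_coprime[OF prime_p, of d] assms(2) nat_dvd_not_less[of d p] by (auto simp: coprime_commute)
  then obtain u v where uv: "d * u = p * v + 1"
    using bezout_nat[OF \<open>d \<noteq> 0\<close>, of p] by auto
  have "(g [^] d) [^] u = (g [^] p) [^] v \<otimes> g"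
    by (simp add: nat_pow_pow uv)
  moreover have "(g [^] d) [^] u \<in> M" "(g [^] p) [^] v \<in> M"
    using assms(1) g_pow by auto
  ultimately have "inv ((g [^] p) [^] v) \<otimes> ((g [^] p) [^] v \<otimes> g) \<in> M"
    by (metis M_simps(2,3))
  then show False using g_M by (simp add: mult_inv_cancel)
qed

lemma decompose_unique:
  assumes "g [^] a \<otimes> m = g [^] a' \<otimes> m'" "a < p" "a' < p" "m \<in> M" "m' \<in> M"
  shows "a = a'"
proof -
  have wlog: "a = a'" if "g [^] a \<otimes> m = g [^] a' \<otimes> m'" "a < p" "a' < p" "m \<in> M" "m' \<in> M" "a \<le> a'"
    for a a' m m'
  proof -
    have "g [^] a \<otimes> m = g [^] a \<otimes> (g [^] (a' - a) \<otimes> m')"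
      using that by (simp add: nat_pow_mult flip: m_assoc)
    then have "m = g [^] (a' - a) \<otimes> m'"
      using that by simp
    then have "g [^] (a' - a) = m \<otimes> inv m'"
      using that by (simp add: m_assoc)
    then have "g [^] (a' - a) \<in> M" using that by simp
    with that have "a' - a = 0" by (intro g_pow_M) auto
    with that show ?thesis by simp
  qed
  show ?thesis
    using wlog[of a m a' m'] wlog[of a' m' a m] assms by (cases "a \<le> a'") auto
qed

definition exponent :: "'a \<Rightarrow> nat" where
  "exponent x = (THE a. a < p \<and> (\<exists>m\<in>M. x = g [^] a \<otimes> m))"

lemma exponent_eq: "\<lbrakk>a < p; m \<in> M\<rbrakk> \<Longrightarrow> exponent (g [^] a \<otimes> m) = a"
  unfolding exponent_def using decompose_unique by (intro the_equality) blast+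

text \<open>Binomial coefficients are the basis of the functions of the digit that is adapted to
  differences: by Pascal's rule a step from \<open>a\<close> to \<open>Suc a\<close> lowers
  \<open>b\<close> by one. With \<open>b = 0\<close> the function \<open>f\<close> is extended
  independently of the digit; with \<open>f = 1\<close> and \<open>b = 1\<close> the result is the
  digit itself.\<close>

definition extend :: "nat \<Rightarrow> ('a \<Rightarrow> 'f::comm_ring_1) \<Rightarrow> 'a \<Rightarrow> 'f" where
  "extend b f x = of_nat (exponent x choose b) * f (inv (g [^] exponent x) \<otimes> x)"

lemma extend_eq: "\<lbrakk>a < p; m \<in> M\<rbrakk> \<Longrightarrow> extend b f (g [^] a \<otimes> m) = of_nat (a choose b) * f m"
  by (simp add: extend_def exponent_eq mult_inv_cancel)

lemma decomposeE:
  assumes "x \<in> H"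
  obtains a m where "a < p" "m \<in> M" "x = g [^] a \<otimes> m"
  using decompose[OF assms] by blast

lemma extend_mult_M:
  assumes "x \<in> H" "h \<in> M"
  shows "extend b f (x \<otimes> h) = extend b (\<lambda>m. f (m \<otimes> h)) x"
proof -
  obtain a m where *: "a < p" "m \<in> M" "x = g [^] a \<otimes> m" using assms(1) by (rule decomposeE)
  then have "x \<otimes> h = g [^] a \<otimes> (m \<otimes> h)" using assms by (simp add: m_assoc)
  then show ?thesis using * assms by (simp add: extend_eq)
qed

text \<open>Right multiplication by \<open>g\<close> raises the digit and conjugates
  \<open>m\<close>. From digit \<open>p - 1\<close> it wraps to 0, and the carry
  \<open>g [^] p\<close>, an element of \<open>M\<close>, appears to the left of the
  conjugate.\<close>

lemma extend_mult_g:
  fixes f :: "'a \<Rightarrow> 'f::comm_ring_1"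
  assumes "a < p" "m \<in> M"
  shows "extend b f (g [^] a \<otimes> m \<otimes> g) =
    (if Suc a < p then of_nat (Suc a choose b) * f (inv g \<otimes> m \<otimes> g)
     else of_nat (0 choose b) * f (g [^] p \<otimes> (inv g \<otimes> m \<otimes> g)))"
proof -
  have *: "g [^] a \<otimes> m \<otimes> g = g [^] Suc a \<otimes> (inv g \<otimes> m \<otimes> g)"
    using assms by (simp add: m_assoc mult_inv_cancel)
  show ?thesis
  proof (cases "Suc a < p")
    case True
    then show ?thesis unfolding * using extend_eq[OF True g_normalizes[OF assms(2)]] by simp
  next
    case False
    then have "Suc a = p" using assms by simp
    then have "g [^] a \<otimes> m \<otimes> g = g [^] (0::nat) \<otimes> (g [^] p \<otimes> (inv g \<otimes> m \<otimes> g))"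
      unfolding * using assms g_normalizes[OF assms(2)] by simp
    then show ?thesis
      using extend_eq[of 0 "g [^] p \<otimes> (inv g \<otimes> m \<otimes> g)" b f] False prime_gt_0_nat[OF prime_p]
        g_normalizes[OF assms(2)] g_pow by simp
  qed
qed

text \<open>The binomial factor costs \<open>b * w\<close> on top of the bound \<open>e\<close> of
  \<open>f\<close>. Differences along \<open>M\<close> act on \<open>f\<close> alone; the difference
  along \<open>g\<close> splits by Pascal's rule into pieces that fit the bound
  \<open>N - w\<close>, so induction on \<open>N\<close> applies. The alternative
  \<open>e = 0\<close> covers the case that truncated subtraction has reduced \<open>f\<close> to
  zero while \<open>b * w\<close> may still exceed \<open>N\<close>.\<close>

lemma polyn_extend:
  fixes f :: "'a \<Rightarrow> 'f::comm_ring_1"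
  assumes char: "of_nat p = (0::'f)"
    and "b < p" "polyn M e f" "e = 0 \<or> e + b * w \<le> N"
  shows "polyn H N (extend b f)"
  using assms(2-)
proof (induction N arbitrary: b e f rule: less_induct)
  case (less N)
  show ?case
  proof (cases "e = 0")
    case True
    show ?thesis
    proof (rule polyn_zero[OF subgroup_H])
      fix x assume "x \<in> H"
      then obtain a m where "a < p" "m \<in> M" "x = g [^] a \<otimes> m" by (rule decomposeE)
      then show "extend b f x = 0" using True less.prems by (simp add: extend_eq)
    qed
  next
    case False
    then have N: "e + b * w \<le> N" "N > 0" using less.prems by auto
    let ?F = "extend b f"
    have diff_M: "polyn H (N - Suc j) (\<lambda>x. ?F (x \<otimes> h) - ?F x)" if h: "h \<in> M" "h \<in> P (Suc j)" for j h
    proof -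
      have "polyn H (N - Suc j) (extend b (\<lambda>x. f (x \<otimes> h) - f x))"
        by (rule less.IH[OF _ less.prems(1) polynD[OF less.prems(2) subgroup_M h]]) (use N in auto)
      then show ?thesis
        by (rule polyn_cong[OF subgroup_H])
          (use h in \<open>simp add: extend_mult_M\<close>, simp add: extend_def algebra_simps)
    qed
    have g_w: "g \<in> P w" using g_H H_series by auto
    have conj: "polyn M d (\<lambda>x. k (inv g \<otimes> x \<otimes> g))" if "polyn M d k" for d and k :: "'a \<Rightarrow> 'f"
      by (rule polyn_conj[OF subgroup_M g_closed _ that]) (rule g_normalizes)
    have conj_diff: "polyn M (e - w) (\<lambda>x. f (inv g \<otimes> x \<otimes> g) - f x)"
      by (rule polyn_conj_diff[OF subgroup_M g_closed _ less.prems(2) w_pos g_w]) (rule g_normalizes)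
    have diff_conj: "polyn H (N - w) (extend b (\<lambda>x. f (inv g \<otimes> x \<otimes> g) - f x))"
      by (rule less.IH[OF _ less.prems(1) conj_diff]) (use N w_pos in auto)
    have diff_g: "polyn H (N - w) (\<lambda>x. ?F (x \<otimes> g) - ?F x)"
    proof (cases b)
      case 0
      \<comment> \<open>The error caused by wrapping: at digit \<open>p - 1\<close> the new value is
        \<open>f\<close> after left translation by the carry, which has weight
        \<open>w * p\<close>.\<close>
      let ?L = "\<lambda>x. f (g [^] p \<otimes> x) - f x"
      have p_w: "p * w > 0" using prime_gt_0_nat[OF prime_p] w_pos by simp
      have "g [^] p \<in> P (Suc (p * w - 1))"
        using series_pow[OF w_pos g_w] p_w by (simp add: mult.commute)
      from polyn_left[OF subgroup_M less.prems(2) g_pow this] p_w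
      have "polyn M (e - p * w) ?L" by simp
      from conj[OF this] have L: "polyn M (e - p * w) (\<lambda>x. ?L (inv g \<otimes> x \<otimes> g))" .
      \<comment> \<open>The left difference gains \<open>p * w\<close>, the binomial factor with
        lower index \<open>p - 1\<close> costs \<open>(p - 1) * w\<close>; the net gain is exactly
        \<open>w\<close>.\<close>
      have deg: "e - p * w = 0 \<or> e - p * w + (p - 1) * w \<le> N - w"
      proof -
        have "p * w = (p - 1) * w + w"
          using prime_gt_0_nat[OF prime_p] by (cases p) auto
        with N(1) show ?thesis by linarith
      qed
      \<comment> \<open>For digits \<open>a < p\<close>, \<open>a choose (p - 1)\<close> is 1 at
        \<open>a = p - 1\<close> and 0 elsewhere, so it singles out the coset on which the wrap
        occurs.\<close>
      have "polyn H (N - w) (extend (p - 1) (\<lambda>x. ?L (inv g \<otimes> x \<otimes> g)))"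
        by (rule less.IH[OF _ _ L deg]) (use N w_pos prime_gt_0_nat[OF prime_p] in simp_all)
      from polyn_add[OF subgroup_H diff_conj this] show ?thesis
      proof (rule polyn_cong[OF subgroup_H])
        fix x assume "x \<in> H"
        then obtain a m where *: "a < p" "m \<in> M" "x = g [^] a \<otimes> m" by (rule decomposeE)
        show "extend b (\<lambda>x. f (inv g \<otimes> x \<otimes> g) - f x) x + extend (p - 1) (\<lambda>x. ?L (inv g \<otimes> x \<otimes> g)) x
            = ?F (x \<otimes> g) - ?F x"
          unfolding *(3) extend_mult_g[OF *(1,2)] extend_eq[OF *(1,2)]
        proof (cases "Suc a < p")
          case True
          with True show "of_nat (a choose b) * (f (inv g \<otimes> m \<otimes> g) - f m) +
            of_nat (a choose (p - 1)) * ?L (inv g \<otimes> m \<otimes> g) =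
            (if Suc a < p then of_nat (Suc a choose b) * f (inv g \<otimes> m \<otimes> g)
             else of_nat (0 choose b) * f (g [^] p \<otimes> (inv g \<otimes> m \<otimes> g))) - of_nat (a choose b) * f m"
            using 0 by (simp add: binomial_eq_0)
        next
          case False
          then have "a = p - 1" using * by simp
          with False show "of_nat (a choose b) * (f (inv g \<otimes> m \<otimes> g) - f m) +
            of_nat (a choose (p - 1)) * ?L (inv g \<otimes> m \<otimes> g) =
            (if Suc a < p then of_nat (Suc a choose b) * f (inv g \<otimes> m \<otimes> g)
             else of_nat (0 choose b) * f (g [^] p \<otimes> (inv g \<otimes> m \<otimes> g))) - of_nat (a choose b) * f m"
            using 0 by simp
        qed
      qed
    next
      case (Suc b')
      have "polyn H (N - w) (extend b' (\<lambda>x. f (inv g \<otimes> x \<otimes> g)))"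
        by (rule less.IH[OF _ _ conj[OF less.prems(2)]]) (use N w_pos Suc less.prems in auto)
      from polyn_add[OF subgroup_H diff_conj this] show ?thesis
      proof (rule polyn_cong[OF subgroup_H])
        fix x assume "x \<in> H"
        then obtain a m where *: "a < p" "m \<in> M" "x = g [^] a \<otimes> m" by (rule decomposeE)
        \<comment> \<open>At the wrap the unwrapped formula has the coefficient
          \<open>p choose b\<close>, which is zero in characteristic \<open>p\<close> since
          \<open>0 < b < p\<close>; the true coefficient \<open>0 choose b\<close> is zero too. So
          Pascal's rule holds here without a correction term.\<close>
        have "of_nat (Suc a choose b) = (0::'f)" if "\<not> Suc a < p"
        proof -
          have "Suc a = p" using that * by simp
          moreover have "p dvd (p choose b)"
            using Primes.dvd_choose_prime[of b p] less.prems Suc prime_p by auto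
          ultimately obtain k where "Suc a choose b = p * k" by (auto elim!: dvdE)
          then show ?thesis using char by simp
        qed
        then have "(if Suc a < p then of_nat (Suc a choose b) * f (inv g \<otimes> m \<otimes> g)
            else of_nat (0 choose b) * f (g [^] p \<otimes> (inv g \<otimes> m \<otimes> g)))
            = of_nat (Suc a choose b) * f (inv g \<otimes> m \<otimes> g)"
          using Suc by simp
        then show "extend b (\<lambda>x. f (inv g \<otimes> x \<otimes> g) - f x) x + extend b' (\<lambda>x. f (inv g \<otimes> x \<otimes> g)) x
            = ?F (x \<otimes> g) - ?F x"
          unfolding *(3) extend_mult_g[OF *(1,2)] extend_eq[OF *(1,2)]
          using Suc by (simp add: algebra_simps)
      qed
    qed
    \<comment> \<open>The elements along which a difference gains at least \<open>w\<close>. They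
      are closed under products and contain \<open>M\<close> and \<open>g\<close>, hence exhaust
      \<open>H\<close>.\<close>
    define Q where "Q = {h \<in> H. polyn H (N - w) (\<lambda>x. ?F (x \<otimes> h) - ?F x)}"
    have Q_mult: "h \<otimes> k \<in> Q" if "h \<in> Q" "k \<in> Q" for h k
    proof -
      have hk: "h \<in> H" "k \<in> H" using that by (auto simp: Q_def)
      have "polyn H (N - w) (\<lambda>x. (?F (x \<otimes> h \<otimes> k) - ?F (x \<otimes> h)) + (?F (x \<otimes> h) - ?F x))"
        using that polyn_translate[OF subgroup_H _ hk(1), of "N - w" "\<lambda>x. ?F (x \<otimes> k) - ?F x"]
        by (intro polyn_add[OF subgroup_H]) (auto simp: Q_def)
      then have "polyn H (N - w) (\<lambda>x. ?F (x \<otimes> (h \<otimes> k)) - ?F x)"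
        by (rule polyn_cong[OF subgroup_H]) (use hk in \<open>simp add: m_assoc\<close>)
      then show ?thesis using hk by (simp add: Q_def)
    qed
    have Q_M: "M \<subseteq> Q"
    proof
      fix h assume h: "h \<in> M"
      then have "h \<in> P (Suc (w - 1))" using H_series w_pos by auto
      from diff_M[OF h this] h w_pos show "h \<in> Q" by (simp add: Q_def)
    qed
    have Q_g: "g [^] (a::nat) \<in> Q" for a
    proof (induction a)
      case 0
      then show ?case using Q_M by auto
    next
      case (Suc a)
      have "g \<in> Q" using diff_g g_H by (simp add: Q_def)
      then show ?case using Q_mult[OF Suc] by simp
    qed
    show ?thesis
    proof (rule polynI)
      fix j h assume h: "h \<in> H" "h \<in> P (Suc j)"
      show "polyn H (N - Suc j) (\<lambda>x. ?F (x \<otimes> h) - ?F x)"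
      proof (cases "h \<in> M")
        case True
        then show ?thesis using diff_M h by simp
      next
        case False
        \<comment> \<open>An element of \<open>H\<close> outside \<open>M\<close> has weight at most
          \<open>w\<close>, because \<open>H \<inter> P (Suc w)\<close> lies in \<open>M\<close>; so
          a gain of \<open>w\<close> is all that its weight demands.\<close>
        have "Suc j \<le> w"
        proof (rule ccontr)
          assume "\<not> Suc j \<le> w"
          then have "h \<in> P (Suc w)" using series_antimono[of "Suc w" "Suc j"] h by auto
          with False h series_M show False by auto
        qed
        obtain a m where am: "a < p" "m \<in> M" "h = g [^] a \<otimes> m" using h(1) by (rule decomposeE)
        have "g [^] a \<otimes> m \<in> Q" using am(2) Q_M by (intro Q_mult[OF Q_g]) auto
        then have "polyn H (N - w) (\<lambda>x. ?F (x \<otimes> h) - ?F x)" using am(3) by (simp add: Q_def)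
        then show ?thesis
          by (rule polyn_mono[OF subgroup_H]) (use \<open>Suc j \<le> w\<close> in simp)
      qed
    qed (use N in simp)
  qed
qed

end

section \<open>Chains of subgroups of index \<open>p\<close> and separating functions\<close>

context restricted_series
begin

text \<open>The group may be infinite, so subgroups above \<open>P n\<close> are measured by the
  number of cosets of \<open>P n\<close> that they meet. This measure serves both the choice of a
  maximal subgroup and the induction down the chain.\<close>

lemma coset_card_strict_mono:
  assumes fin: "finite (rcosets (P n))" and K: "subgroup K G" and "P n \<subseteq> K" "K \<subset> H" "H \<subseteq> carrier G"
  shows "card ((\<lambda>x. P n #> x) ` K) < card ((\<lambda>x. P n #> x) ` H)"
proof (rule psubset_card_mono)
  have "(\<lambda>x. P n #> x) ` H \<subseteq> rcosets (P n)"
    using assms by (auto simp: RCOSETS_def)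
  with fin show "finite ((\<lambda>x. P n #> x) ` H)" by (rule rev_finite_subset)
  obtain g where g: "g \<in> H" "g \<notin> K" using assms by auto
  have "P n #> g \<noteq> P n #> x" if "x \<in> K" for x
  proof
    assume "P n #> g = P n #> x"
    moreover have "g \<in> P n #> g"
      by (rule rcos_self[OF _ subgroup_series]) (use g assms(5) in auto)
    ultimately obtain y where "y \<in> P n" "g = y \<otimes> x" by (auto simp: r_coset_def)
    then show False using that g assms(3) subgroup.m_closed[OF K] by blast
  qed
  with g assms(4) show "(\<lambda>x. P n #> x) ` K \<subset> (\<lambda>x. P n #> x) ` H" by blast
qed

text \<open>Take \<open>w\<close> maximal with \<open>H \<subseteq> P w\<close>. Commutators and
  \<open>p\<close>-th powers of elements of \<open>H\<close> fall into \<open>P (Suc w)\<close>, so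
  \<open>H\<close> modulo \<open>H \<inter> P (Suc w)\<close> is elementary abelian, and a maximal
  proper subgroup \<open>M\<close> above this intersection has index \<open>p\<close>.\<close>

lemma obtain_layer:
  assumes fin: "finite (rcosets (P n))" and H: "subgroup H G" and "P n \<subseteq> H" "\<not> H \<subseteq> P n" "n > 0"
  obtains M g w where "series_layer G P p H M g w" "P n \<subseteq> M" "M \<subset> H" "w < n"
proof -
  define w where "w = (LEAST i. \<not> H \<subseteq> P (Suc i))"
  have ex: "\<not> H \<subseteq> P (Suc (n - 1))" using assms by simp
  have w: "\<not> H \<subseteq> P (Suc w)" unfolding w_def by (rule LeastI[of "\<lambda>i. \<not> H \<subseteq> P (Suc i)", OF ex])
  have "w \<le> n - 1" unfolding w_def by (rule Least_le[of "\<lambda>i. \<not> H \<subseteq> P (Suc i)", OF ex])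
  then have w_n: "w < n" using assms by simp
  have w_pos: "w > 0" using w series_1 subgroup.subset[OF H] by (cases w) auto
  have H_w: "H \<subseteq> P w"
    using not_less_Least[of "w - 1" "\<lambda>i. \<not> H \<subseteq> P (Suc i)"] w_pos by (simp add: w_def[symmetric])
  define \<mu> where "\<mu> K = card ((\<lambda>x. P n #> x) ` K)" for K
  define C where "C K \<longleftrightarrow> subgroup K G \<and> H \<inter> P (Suc w) \<subseteq> K \<and> K \<subset> H" for K
  have n_w: "P n \<subseteq> H \<inter> P (Suc w)" using assms w_n series_antimono[of "Suc w" n] by auto
  have strict: "\<mu> K < \<mu> K'" if "C K" "K \<subset> K'" "K' \<subseteq> H" for K K'
    unfolding \<mu>_def using that n_w subgroup.subset[OF H]
    by (intro coset_card_strict_mono fin) (auto simp: C_def)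
  have "C (H \<inter> P (Suc w))"
    using w by (auto simp: C_def intro!: subgroups_Inter_pair H subgroup_series)
  moreover have "\<forall>K. C K \<longrightarrow> \<mu> K < \<mu> H" using strict by (auto simp: C_def)
  ultimately obtain M where M: "C M" and M_max: "\<And>K. C K \<Longrightarrow> \<mu> K \<le> \<mu> M"
    using ex_has_greatest_nat[of C _ \<mu> "\<mu> H"] by blast
  have maximal: "K = H" if "subgroup K G" "M \<subset> K" "K \<subseteq> H" for K
  proof (rule ccontr)
    assume "K \<noteq> H"
    with that M have "C K" by (auto simp: C_def)
    with M_max[of K] strict[OF M that(2,3)] show False by simp
  qed
  have sub_M: "subgroup M G" and series_M: "H \<inter> P (Suc w) \<subseteq> M" and M_H: "M \<subset> H"
    using M by (auto simp: C_def)
  obtain g where g: "g \<in> H" "g \<notin> M" using M_H by auto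
  have gc [simp]: "g \<in> carrier G" using g subgroup.subset[OF H] by auto
  have Mc [simp]: "x \<in> carrier G" if "x \<in> M" for x using that subgroup.subset[OF sub_M] by auto
  note M_closed [simp] = subgroup.m_closed[OF sub_M] subgroup.m_inv_closed[OF sub_M] subgroup.one_closed[OF sub_M]
  have normalizes: "inv g \<otimes> x \<otimes> g \<in> M" if x: "x \<in> M" for x
  proof -
    have xH: "x \<in> H" using x M_H by auto
    have "inv x \<otimes> inv g \<otimes> x \<otimes> g \<in> H"
      using xH g by (simp add: subgroup.m_closed[OF H] subgroup.m_inv_closed[OF H])
    moreover have "inv x \<otimes> inv g \<otimes> x \<otimes> g \<in> P (w + w)"
      using xH g H_w w_pos by (intro series_comm) auto
    then have "inv x \<otimes> inv g \<otimes> x \<otimes> g \<in> P (Suc w)"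
      using series_antimono[of "Suc w" "w + w"] w_pos by auto
    ultimately have "inv x \<otimes> inv g \<otimes> x \<otimes> g \<in> M" using series_M by auto
    then have "x \<otimes> (inv x \<otimes> inv g \<otimes> x \<otimes> g) \<in> M" using x by simp
    then show ?thesis using x by (simp add: m_assoc mult_inv_cancel)
  qed
  have g_pow: "g [^] p \<in> M"
  proof -
    have "2 * w \<le> w * p" using prime_ge_2_nat[OF prime_p] by simp
    then have "Suc w \<le> w * p" using w_pos by linarith
    then have "g [^] p \<in> P (Suc w)"
      using series_pow[OF w_pos, of g] g H_w series_antimono[of "Suc w" "w * p"] by auto
    moreover have "g [^] p \<in> H" using subgroup_int_pow_closed[OF H g(1), of "int p"] by (simp add: int_pow_int)
    ultimately show ?thesis using series_M by auto
  qed
  have pow_M: "x [^] (a::nat) \<in> M" if "x \<in> M" for x a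
    using that by (induction a) auto
  have normalizes_pow: "inv (g [^] a) \<otimes> x \<otimes> g [^] a \<in> M" if "x \<in> M" for x and a :: nat
  proof (induction a)
    case (Suc a)
    have "inv g \<otimes> (inv (g [^] a) \<otimes> x \<otimes> g [^] a) \<otimes> g \<in> M" by (rule normalizes[OF Suc])
    also have "inv g \<otimes> (inv (g [^] a) \<otimes> x \<otimes> g [^] a) \<otimes> g = inv (g [^] Suc a) \<otimes> x \<otimes> g [^] Suc a"
      using that by (simp add: m_assoc inv_mult_group)
    finally show ?case .
  qed (use that in simp)
  \<comment> \<open>Since \<open>g\<close> normalizes \<open>M\<close>, the cosets of its powers
    form a subgroup strictly above \<open>M\<close>; maximality makes it all of
    \<open>H\<close>.\<close>
  define K where "K = {g [^] a \<otimes> m | (a::nat) m. m \<in> M}"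
  have K_I: "g [^] a \<otimes> m \<in> K" if "m \<in> M" for a :: nat and m using that by (auto simp: K_def)
  have K_mult: "x \<otimes> y \<in> K" if xy: "x \<in> K" "y \<in> K" for x y
  proof -
    obtain a m b l where *: "x = g [^] (a::nat) \<otimes> m" "y = g [^] (b::nat) \<otimes> l" "m \<in> M" "l \<in> M"
      using xy by (auto simp: K_def)
    have "x \<otimes> y = g [^] (a + b) \<otimes> (inv (g [^] b) \<otimes> m \<otimes> g [^] b \<otimes> l)"
      using * by (simp add: m_assoc mult_inv_cancel flip: nat_pow_mult)
    then show ?thesis using K_I normalizes_pow * by simp
  qed
  have "subgroup K G"
  proof (rule subgroupI)
    show "K \<subseteq> carrier G" by (auto simp: K_def)
    show "K \<noteq> {}" using K_I[of \<one>] by auto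
    show "inv x \<in> K" if x: "x \<in> K" for x
    proof -
      obtain a m where *: "x = g [^] (a::nat) \<otimes> m" "m \<in> M" using x by (auto simp: K_def)
      \<comment> \<open>This power of \<open>g\<close> completes the exponent \<open>a\<close> of
        \<open>x\<close> to the multiple \<open>p * a\<close>, so \<open>l\<close> lies in
        \<open>M\<close>, and the inverse of \<open>x\<close> is expressed without negative powers
        of \<open>g\<close>.\<close>
      define l where "l = g [^] (a * (p - 1)) \<otimes> x"
      have "a * (p - 1) + a = p * a"
        using prime_gt_0_nat[OF prime_p] by (cases p) auto
      then have "l = (g [^] p) [^] a \<otimes> m"
        using * by (simp add: l_def nat_pow_pow nat_pow_mult flip: m_assoc)
      then have l: "l \<in> M" using g_pow pow_M * by simp
      have "inv x = inv l \<otimes> g [^] (a * (p - 1))"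
        using * by (simp add: l_def inv_mult_group m_assoc)
      also have "\<dots> = (g [^] (0::nat) \<otimes> inv l) \<otimes> (g [^] (a * (p - 1)) \<otimes> \<one>)"
        using l by simp
      also have "\<dots> \<in> K" using l by (intro K_mult K_I) auto
      finally show ?thesis .
    qed
  qed (rule K_mult)
  moreover have "M \<subseteq> K" using K_I[of _ 0] by auto
  moreover have "g \<in> K" using K_I[of \<one> 1] by simp
  moreover have "K \<subseteq> H"
  proof -
    have "g [^] (a::nat) \<in> H" for a
      using subgroup_int_pow_closed[OF H g(1), of "int a"] by (simp add: int_pow_int)
    then show ?thesis using M_H by (auto simp: K_def intro!: subgroup.m_closed[OF H])
  qed
  ultimately have "K = H" using maximal[of K] g by blast
  have "series_layer G P p H M g w"
  proof (intro series_layer.intro restricted_series_axioms series_layer_axioms.intro)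
    fix x assume "x \<in> H"
    then obtain a m where *: "x = g [^] (a::nat) \<otimes> m" "m \<in> M" using \<open>K = H\<close> by (auto simp: K_def)
    have "g [^] a = g [^] (a mod p) \<otimes> (g [^] p) [^] (a div p)"
      by (simp add: nat_pow_pow nat_pow_mult)
    then have "x = g [^] (a mod p) \<otimes> ((g [^] p) [^] (a div p) \<otimes> m)"
      using * by (simp add: m_assoc)
    moreover have "(g [^] p) [^] (a div p) \<otimes> m \<in> M" using * g_pow pow_M by simp
    ultimately show "\<exists>a<p. \<exists>m\<in>M. x = g [^] a \<otimes> m"
      using prime_gt_0_nat[OF prime_p] by (intro exI[of _ "a mod p"]) auto
  qed (use H sub_M M_H w_pos H_w series_M g normalizes g_pow in auto)
  then show ?thesis using that[of M g w] n_w series_M M_H w_n by auto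
qed

text \<open>
  Dual form of Jennings' theorem. The separating functions are products of binomial coefficients in
  the coordinates along a chain of subgroups of index \<open>p\<close>; a coordinate along a layer of weight \<open>w\<close>
  has degree \<open>w\<close>.
\<close>
theorem polyn_separates:
  assumes char: "\<And>a. of_nat a = (0::'f::comm_ring_1) \<longleftrightarrow> p dvd a"
    and fin: "finite (rcosets (P n))" and "n > 0"
    and H: "subgroup H G" "P n \<subseteq> H" and h: "h \<in> H" "h \<notin> P n"
  shows "\<exists>f :: 'a \<Rightarrow> 'f. polyn H n f \<and> f h \<noteq> f \<one>"
  using H h
proof (induction "card ((\<lambda>x. P n #> x) ` H)" arbitrary: H h rule: less_induct)
  case less
  from obtain_layer[OF fin less.prems(1,2) _ \<open>n > 0\<close>] less.prems
  obtain M g w where layer: "series_layer G P p H M g w" and M: "P n \<subseteq> M" "M \<subset> H" "w < n"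
    by blast
  interpret series_layer G P p H M g w by (rule layer)
  have char_p: "of_nat p = (0::'f)" using char by simp
  have one: "\<one> = g [^] (0::nat) \<otimes> \<one>" by simp
  have p: "0 < p" "1 < p" using prime_gt_0_nat[OF prime_p] prime_gt_1_nat[OF prime_p] by auto
  show ?case
  proof (cases "h \<in> M")
    case True
    have "card ((\<lambda>x. P n #> x) ` M) < card ((\<lambda>x. P n #> x) ` H)"
      using M subgroup_M subgroup.subset[OF subgroup_H] by (intro coset_card_strict_mono fin)
    from less.hyps[OF this subgroup_M M(1) True less.prems(4)]
    obtain f :: "'a \<Rightarrow> 'f" where f: "polyn M n f" "f h \<noteq> f \<one>" by blast
    have "polyn H n (extend 0 f)"
      by (rule polyn_extend[OF char_p p(1) f(1)]) simp
    moreover have "extend 0 f x = f x" if "x \<in> M" for x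
      using extend_eq[OF p(1) that, of 0 f] that by simp
    ultimately show ?thesis using f True by (intro exI[of _ "extend 0 f"]) simp
  next
    case False
    obtain a m where am: "a < p" "m \<in> M" "h = g [^] a \<otimes> m" using less.prems(3) by (rule decomposeE)
    have "a \<noteq> 0" using False am by (cases a) auto
    \<comment> \<open>The digit modulo \<open>p\<close>, with degree bound \<open>1 + w\<close>,
      which is at most \<open>n\<close> because \<open>w < n\<close>. It vanishes at the identity
      and equals \<open>a\<close>, with \<open>0 < a < p\<close>, at \<open>h\<close>.\<close>
    let ?f = "extend 1 (\<lambda>_. 1 :: 'f)"
    have "polyn M 1 (\<lambda>_. 1 :: 'f)" by simp
    then have "polyn H n ?f"
      by (rule polyn_extend[OF char_p p(2)]) (use M in simp)
    moreover have "?f h = of_nat a" using extend_eq[OF am(1,2), of 1 "\<lambda>_. 1 :: 'f"] am by simp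
    moreover have "?f \<one> = 0" using extend_eq[of 0 \<one> 1 "\<lambda>_. 1 :: 'f"] p by simp
    moreover have "of_nat a \<noteq> (0::'f)" using char \<open>a \<noteq> 0\<close> am by (auto dest: dvd_imp_le)
    ultimately show ?thesis by auto
  qed
qed

end

section \<open>Differences along words\<close>

context group
begin

text \<open>The difference along the first letter is the outermost one, so stripping that letter
  only moves the base point from \<open>z\<close> to \<open>z \<otimes> x\<close>.\<close>

primrec word_diff :: "'a list \<Rightarrow> ('a \<Rightarrow> 'f::comm_ring_1) \<Rightarrow> 'a \<Rightarrow> 'f" where
  "word_diff [] f = f"
| "word_diff (x # u) f = (\<lambda>z. word_diff u f (z \<otimes> x) - word_diff u f z)"

definition list_prod :: "'a list \<Rightarrow> 'a" where
  "list_prod xs = foldr (\<otimes>) xs \<one>"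

lemma list_prod_simps [simp]: "list_prod [] = \<one>" "list_prod (x # xs) = x \<otimes> list_prod xs"
  by (simp_all add: list_prod_def)

lemma list_prod_closed: "set xs \<subseteq> carrier G \<Longrightarrow> list_prod xs \<in> carrier G"
  by (induction xs) auto

lemma list_prod_append:
  "\<lbrakk>set xs \<subseteq> carrier G; set ys \<subseteq> carrier G\<rbrakk> \<Longrightarrow> list_prod (xs @ ys) = list_prod xs \<otimes> list_prod ys"
  by (induction xs) (auto simp: m_assoc list_prod_closed)

text \<open>Right translation by \<open>x\<close> is the identity plus the difference along
  \<open>x\<close>. Multiplying out these factors gives one term for each subsequence, counted with
  multiplicity.\<close>

lemma eval_list_prod:
  fixes f :: "'a \<Rightarrow> 'f::comm_ring_1"
  assumes "set xs \<subseteq> carrier G" "z \<in> carrier G"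
  shows "f (z \<otimes> list_prod xs) = (\<Sum>u\<leftarrow>subseqs xs. word_diff u f z)"
  using assms
proof (induction xs arbitrary: z)
  case (Cons x xs)
  then have "f (z \<otimes> list_prod (x # xs)) = f (z \<otimes> x \<otimes> list_prod xs)"
    by (simp add: m_assoc list_prod_closed)
  also have "\<dots> = (\<Sum>u\<leftarrow>subseqs xs. word_diff u f (z \<otimes> x))"
    using Cons by simp
  also have "\<dots> = (\<Sum>u\<leftarrow>subseqs xs. word_diff (x # u) f z + word_diff u f z)"
    by simp
  also have "\<dots> = (\<Sum>u\<leftarrow>subseqs (x # xs). word_diff u f z)"
    by (simp add: sum_list_addf sum_list_subtractf Let_def comp_def)
  finally show ?case .
qed simp

end

lemma (in restricted_series) word_diff_eq_0:
  fixes f :: "'a \<Rightarrow> 'f::comm_ring_1"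
  assumes "polyn (carrier G) n f" "set u \<subseteq> carrier G" "n \<le> length u" "z \<in> carrier G"
  shows "word_diff u f z = 0"
proof -
  have "polyn (carrier G) (n - length u) (word_diff u f)"
    using assms(2)
  proof (induction u)
    case (Cons x u)
    then have "polyn (carrier G) (n - length u - Suc 0) (word_diff (x # u) f)"
      unfolding word_diff.simps by (intro polynD subgroup_self) (auto simp: series_1)
    then show ?case by simp
  qed (use assms in simp)
  then show ?thesis using assms by simp
qed

section \<open>Unitriangular representations\<close>

lemma count_list_map_Cons:
  "count_list (map ((#) x) L) v = (case v of [] \<Rightarrow> 0 | y # v' \<Rightarrow> if x = y then count_list L v' else 0)"
  by (induction L) (auto split: list.splits)

text \<open>The size \<open>n\<close> is independent of \<open>length w\<close>, so that words of
  all lengths below \<open>n\<close> yield matrices in the same group; rows from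
  \<open>length w\<close> on are those of the identity.\<close>

definition word_mat :: "nat \<Rightarrow> 'a list \<Rightarrow> 'a \<Rightarrow> 'f::field mat" where
  "word_mat n w x = mat n n (\<lambda>(i, j).
     if i = j then 1 else if j = Suc i \<and> i < length w \<and> w ! i = x then 1 else 0)"

lemma word_mat_carrier [simp]: "word_mat n w x \<in> carrier_mat n n"
  by (simp add: word_mat_def)

lemma word_mat_mult_index:
  fixes B :: "'f::field mat"
  assumes "B \<in> carrier_mat n n" "i < n" "l < n" "length w < n"
  shows "(word_mat n w x * B) $$ (i, l)
    = B $$ (i, l) + (if i < length w \<and> w ! i = x then B $$ (Suc i, l) else 0)"
proof -
  let ?c = "\<lambda>k. if k = Suc i \<and> i < length w \<and> w ! i = x then B $$ (k, l) else 0"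
  have "(word_mat n w x * B) $$ (i, l) = (\<Sum>k<n. (if k = i then B $$ (k, l) else 0) + ?c k)"
    using assms by (auto simp: word_mat_def scalar_prod_def atLeast0LessThan intro!: sum.cong)
  also have "\<dots> = B $$ (i, l) + (\<Sum>k<n. ?c k)"
    using assms by (simp add: sum.distrib)
  also have "(\<Sum>k<n. ?c k) = (if i < length w \<and> w ! i = x then B $$ (Suc i, l) else 0)"
    using assms by auto
  finally show ?thesis .
qed

definition word_mats :: "nat \<Rightarrow> 'a list \<Rightarrow> 'a list \<Rightarrow> 'f::field mat" where
  "word_mats n w xs = foldr (\<lambda>x B. word_mat n w x * B) xs (1\<^sub>m n)"

lemma word_mats_simps [simp]:
  "word_mats n w [] = 1\<^sub>m n" "word_mats n w (x # xs) = word_mat n w x * word_mats n w xs"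
  by (simp_all add: word_mats_def)

lemma word_mats_carrier [simp]: "word_mats n w xs \<in> carrier_mat n n"
  by (induction xs) (auto intro!: mult_carrier_mat)

text \<open>These entries are Magnus coefficients read in the field. A subsequence of
  \<open>x # xs\<close> equal to \<open>drop i w\<close> either skips \<open>x\<close> or spends it
  on the letter \<open>w ! i\<close>; this is the row operation performed by
  \<open>word_mat n w x\<close>. The row \<open>i\<close> is general for the sake of the induction;
  row 0 is the one applied later.\<close>

lemma word_mats_index:
  assumes "length w < n" "i \<le> length w"
  shows "(word_mats n w xs :: 'f::field mat) $$ (i, length w) = of_nat (count_list (subseqs xs) (drop i w))"
  using assms(2)
proof (induction xs arbitrary: i)
  case Nil
  then show ?case using assms(1) by (auto simp: drop_eq_Nil)
next
  case (Cons x xs)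
  have "(word_mats n w (x # xs) :: 'f mat) $$ (i, length w)
      = of_nat (count_list (subseqs xs) (drop i w))
        + (if i < length w \<and> w ! i = x then of_nat (count_list (subseqs xs) (drop (Suc i) w)) else 0)"
    using Cons assms(1) by (simp add: word_mat_mult_index)
  also have "\<dots> = of_nat (count_list (subseqs (x # xs)) (drop i w))"
  proof (cases "i < length w")
    case True
    then have "drop i w = w ! i # drop (Suc i) w" by (rule Cons_nth_drop_Suc[symmetric])
    then show ?thesis using True by (auto simp: Let_def count_list_map_Cons)
  qed (auto simp: Let_def count_list_map_Cons)
  finally show ?case .
qed

text \<open>The universal property reaches pro-\<open>p\<close> targets only, and the full linear
  group is in general not one. Over the field with \<open>p\<close> elements the unitriangular
  matrices form a finite \<open>p\<close>-group, and they contain all word matrices.\<close>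

definition unitri :: "nat \<Rightarrow> 'f::field mat set" where
  "unitri n = {A \<in> carrier_mat n n. upper_triangular A \<and> (\<forall>i<n. A $$ (i, i) = 1)}"

lemma word_mat_unitri: "word_mat n w x \<in> unitri n"
  by (auto simp: unitri_def word_mat_def upper_triangular_def)

lemma unitri_mult:
  fixes A B :: "'f::field mat"
  assumes "A \<in> unitri n" "B \<in> unitri n"
  shows "A * B \<in> unitri n"
proof -
  have A: "A \<in> carrier_mat n n" "\<And>i j. j < i \<Longrightarrow> i < n \<Longrightarrow> A $$ (i, j) = 0" "\<And>i. i < n \<Longrightarrow> A $$ (i, i) = 1"
    using assms(1) by (auto simp: unitri_def)
  have B: "B \<in> carrier_mat n n" "\<And>i j. j < i \<Longrightarrow> i < n \<Longrightarrow> B $$ (i, j) = 0" "\<And>i. i < n \<Longrightarrow> B $$ (i, i) = 1"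
    using assms(2) by (auto simp: unitri_def)
  have index: "(A * B) $$ (i, j) = (\<Sum>k<n. A $$ (i, k) * B $$ (k, j))" if "i < n" "j < n" for i j
    using that A(1) B(1) by (auto simp: scalar_prod_def atLeast0LessThan)
  have "A $$ (i, k) * B $$ (k, j) = 0" if "j < i" "i < n" "k < n" for i j k
    using A(2)[of k i] B(2)[of j k] that by (cases "k < i") auto
  then have "(A * B) $$ (i, j) = 0" if "j < i" "i < n" for i j
    using that by (subst index) (auto intro!: sum.neutral)
  moreover have "(A * B) $$ (i, i) = 1" if "i < n" for i
  proof -
    have "A $$ (i, k) * B $$ (k, i) = (if k = i then 1 else 0)" if "k < n" for k
      using A(2)[of k i] A(3)[of i] B(2)[of i k] B(3)[of i] that \<open>i < n\<close>
      by (cases "k < i"; cases "k = i") auto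
    then show ?thesis using that by (simp add: index)
  qed
  ultimately show ?thesis using A(1) B(1) by (auto simp: unitri_def)
qed

lemma unitri_one: "1\<^sub>m n \<in> unitri n"
  by (auto simp: unitri_def)

definition strict_pairs :: "nat \<Rightarrow> (nat \<times> nat) set" where
  "strict_pairs n = {(i, j). i < j \<and> j < n}"

lemma bij_betw_unitri:
  "bij_betw (\<lambda>A. restrict (($$) A) (strict_pairs n)) (unitri n) (strict_pairs n \<rightarrow>\<^sub>E (UNIV :: 'f::field set))"
proof -
  define M :: "(nat \<times> nat \<Rightarrow> 'f) \<Rightarrow> 'f mat"
    where "M f = mat n n (\<lambda>p. if fst p < snd p then f p else if fst p = snd p then 1 else 0)" for f
  show ?thesis
  proof (rule bij_betw_byWitness[where f' = M])
    show "\<forall>A \<in> unitri n. M (restrict (($$) A) (strict_pairs n)) = A"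
      by (auto simp: M_def unitri_def upper_triangular_def strict_pairs_def intro!: eq_matI)
    show "\<forall>f \<in> strict_pairs n \<rightarrow>\<^sub>E UNIV. restrict (($$) (M f)) (strict_pairs n) = f"
    proof
      fix f :: "nat \<times> nat \<Rightarrow> 'f" assume "f \<in> strict_pairs n \<rightarrow>\<^sub>E UNIV"
      then show "restrict (($$) (M f)) (strict_pairs n) = f"
        by (intro extensionalityI[of _ "strict_pairs n"]) (auto simp: M_def strict_pairs_def PiE_def)
    qed
    show "M ` (strict_pairs n \<rightarrow>\<^sub>E UNIV) \<subseteq> unitri n"
      by (auto simp: M_def unitri_def upper_triangular_def)
  qed auto
qed

lemma finite_strict_pairs: "finite (strict_pairs n)"
  unfolding strict_pairs_def by (rule finite_subset[of _ "{..<n} \<times> {..<n}"]) auto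

lemma finite_unitri: "finite (unitri n :: 'f::{field,finite} mat set)"
  by (subst bij_betw_finite[OF bij_betw_unitri]) (intro finite_PiE finite_strict_pairs, simp)

lemma card_unitri:
  "card (unitri n :: 'f::{field,finite} mat set) = CARD('f) ^ card (strict_pairs n)"
  using bij_betw_same_card[OF bij_betw_unitri[of n, where 'f = 'f]] by (simp add: card_PiE finite_strict_pairs)

lemma unitri_Units: "A \<in> unitri n \<Longrightarrow> A \<in> Units (ring_mat TYPE('f::field) n ())"
  by (intro det_non_zero_imp_unit) (auto simp: unitri_def det_upper_triangular diag_mat_def)

lemma GL_simps:
  "carrier (GL n) = Units (ring_mat TYPE('f::field) n ())"
  "mult (GL n) = ((*) :: 'f mat \<Rightarrow> _)" "one (GL n) = (1\<^sub>m n :: 'f mat)"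
  by (simp_all add: GL_def units_of_def ring_mat_simps)

lemma GL_group: "group (GL n :: 'f::field mat monoid)"
proof -
  interpret ring "ring_mat TYPE('f) n ()" by (rule ring_mat)
  show ?thesis unfolding GL_def by (rule units_group)
qed

lemma GL_carrier_mat: "A \<in> carrier (GL n :: 'f::field mat monoid) \<Longrightarrow> A \<in> carrier_mat n n"
  by (auto simp: GL_simps Units_def ring_mat_simps)

lemma subgroup_unitri: "subgroup (unitri n) (GL n :: 'f::{field,finite} mat monoid)"
proof -
  interpret group "GL n :: 'f mat monoid" by (rule GL_group)
  show ?thesis
  proof (rule subgroupI)
    fix A :: "'f mat" assume A: "A \<in> unitri n"
    have carrier: "B \<in> carrier (GL n)" if "B \<in> unitri n" for B :: "'f mat"
      using unitri_Units[OF that] by (simp add: GL_simps)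
    \<comment> \<open>No inverse matrix is computed: left multiplication by \<open>A\<close> is
      injective on a finite set that it preserves, hence it hits the identity matrix.\<close>
    have inj: "inj_on ((*) A) (unitri n)"
      using mult_inv_cancel(2)[OF carrier[OF A] carrier]
      by (intro inj_on_inverseI[of _ "(*) (inv\<^bsub>GL n\<^esub> A)"]) (simp add: GL_simps)
    have "(*) A ` unitri n = unitri n"
      by (rule endo_inj_surj[OF finite_unitri _ inj]) (use A unitri_mult in auto)
    then obtain B where B: "B \<in> unitri n" "A * B = 1\<^sub>m n"
      using unitri_one[of n] by (metis imageE)
    then have "inv\<^bsub>GL n\<^esub> A = B"
      using inv_equality[OF inv_comm, of A B] carrier[OF A] carrier[of B] by (simp add: GL_simps)
    then show "inv\<^bsub>GL n\<^esub> A \<in> unitri n" using B by simp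
  next
    show "unitri n \<subseteq> carrier (GL n :: 'f mat monoid)" using unitri_Units by (auto simp: GL_simps)
    show "unitri n \<noteq> ({} :: 'f mat set)" using unitri_one by blast
  qed (use unitri_mult in \<open>auto simp: GL_simps\<close>)
qed

section \<open>Finite discrete targets\<close>

lemma pro_p_group_discrete:
  fixes H :: "'b monoid"
  assumes "group H" "finite (carrier H)" "card (carrier H) = p ^ k" "prime p"
  shows "pro_p_group p H (discrete_topology (carrier H))"
proof -
  interpret group H by fact
  have "topological_group H (discrete_topology (carrier H))"
    unfolding topological_group_def
    by (auto simp: group_axioms simp flip: prod_topology_discrete_topology)
  moreover have "totally_disconnected_space (discrete_topology (carrier H))"
    by (auto simp: totally_disconnected_space_def connectedin_discrete_topology)
  moreover have "\<exists>j. card (rcosets\<^bsub>H\<^esub> N) = p ^ j" if "N \<lhd> H" for N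
  proof -
    have "card (rcosets\<^bsub>H\<^esub> N) * card N = p ^ k"
      using lagrange[OF normal_imp_subgroup[OF that]] assms by (simp add: Coset.order_def)
    then have "card (rcosets\<^bsub>H\<^esub> N) dvd p ^ k" by (metis dvd_triv_left)
    then show ?thesis using divides_primepow_nat[OF assms(4)] by auto
  qed
  ultimately show ?thesis
    using assms by (auto simp: pro_p_group_def profinite_group_def compact_space_discrete_topology)
qed

text \<open>The universal property is stated for one carrier type. A finite target of any type is
  copied there along an injection into \<open>nat\<close>, and the lift is composed with the inverse
  of the copy. For a discrete target, convergence to one means that only finitely many generators
  have nontrivial images.\<close>

lemma free_pro_p_group_on_lift:
  fixes S :: "('a, 'm) monoid_scheme" and Q :: "('b, 'k) monoid_scheme"
  assumes free: "free_pro_p_group_on p X S T" and "prime p"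
    and Q: "group Q" "finite (carrier Q)" "card (carrier Q) = p ^ k"
    and \<phi>: "\<phi> \<in> X \<rightarrow> carrier Q" "finite {x \<in> X. \<phi> x \<noteq> \<one>\<^bsub>Q\<^esub>}"
  obtains f where "f \<in> continuous_hom S T Q (discrete_topology (carrier Q))" "\<And>x. x \<in> X \<Longrightarrow> f x = \<phi> x"
proof -
  interpret Q: group Q by fact
  obtain e0 :: "'b \<Rightarrow> nat" where "inj_on e0 (carrier Q)"
    using finite_imp_inj_to_nat_seg[OF Q(2)] by blast
  define e :: "'b \<Rightarrow> 'a + nat" where "e = Inr \<circ> e0"
  have e: "inj_on e (carrier Q)"
    using \<open>inj_on e0 (carrier Q)\<close> by (auto simp: e_def inj_on_def)
  define d where "d = inv_into (carrier Q) e"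
  have de [simp]: "d (e x) = x" if "x \<in> carrier Q" for x
    using e that by (simp add: d_def)
  define H :: "('a + nat) monoid" where
    "H = \<lparr>carrier = e ` carrier Q, mult = (\<lambda>x y. e (d x \<otimes>\<^bsub>Q\<^esub> d y)), one = e \<one>\<^bsub>Q\<^esub>\<rparr>"
  have H_simps [simp]: "carrier H = e ` carrier Q" "x \<otimes>\<^bsub>H\<^esub> y = e (d x \<otimes>\<^bsub>Q\<^esub> d y)" "\<one>\<^bsub>H\<^esub> = e \<one>\<^bsub>Q\<^esub>" for x y
    by (simp_all add: H_def)
  have "group H"
  proof (rule groupI)
    fix x assume "x \<in> carrier H"
    then obtain y where "y \<in> carrier Q" "x = e y" by auto
    then show "\<exists>z\<in>carrier H. z \<otimes>\<^bsub>H\<^esub> x = \<one>\<^bsub>H\<^esub>"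
      by (intro bexI[of _ "e (inv\<^bsub>Q\<^esub> y)"]) auto
  qed (auto simp: Q.m_assoc)
  then have "pro_p_group p H (discrete_topology (carrier H))"
    by (rule pro_p_group_discrete) (use Q assms(2) e in \<open>simp_all add: card_image\<close>)
  moreover have "e \<circ> \<phi> \<in> X \<rightarrow> carrier H" using \<phi> by auto
  moreover have "converges_to_one H (discrete_topology (carrier H)) X (e \<circ> \<phi>)"
    unfolding converges_to_one_def by (auto intro: rev_finite_subset[OF \<phi>(2)])
  ultimately obtain f where f: "f \<in> continuous_hom S T H (discrete_topology (carrier H))" "\<forall>x\<in>X. f x = (e \<circ> \<phi>) x"
    using free unfolding free_pro_p_group_on_def by blast
  have "d \<in> hom H Q" by (auto simp: hom_def)
  then have "d \<circ> f \<in> hom S Q"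
    using f(1) unfolding continuous_hom_def by (blast intro: hom_compose)
  moreover have "continuous_map T (discrete_topology (carrier Q)) (d \<circ> f)"
  proof (rule continuous_map_compose)
    show "continuous_map T (discrete_topology (carrier H)) f"
      using f(1) unfolding continuous_hom_def by blast
  qed auto
  ultimately have "d \<circ> f \<in> continuous_hom S T Q (discrete_topology (carrier Q))"
    by (simp add: continuous_hom_def)
  moreover have "(d \<circ> f) x = \<phi> x" if "x \<in> X" for x
  proof -
    have "\<phi> x \<in> carrier Q" using \<phi>(1) that by auto
    then show ?thesis using f(2) that by simp
  qed
  ultimately show ?thesis using that by blast
qed

section \<open>Compact groups and the Zassenhaus filtration\<close>

lemma (in group) subgroup_set_mult_normal:
  assumes A: "subgroup A G" and B: "B \<lhd> G"
  shows "subgroup (A <#> B) G"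
proof (rule subgroupI)
  have B_sub: "subgroup B G" and B_conj: "\<And>x h. \<lbrakk>x \<in> carrier G; h \<in> B\<rbrakk> \<Longrightarrow> x \<otimes> h \<otimes> inv x \<in> B"
    using B by (auto simp: normal_inv_iff)
  note A_car = subgroup.mem_carrier[OF A] and B_car = subgroup.mem_carrier[OF B_sub]
  have I: "a \<otimes> b \<in> A <#> B" if "a \<in> A" "b \<in> B" for a b using that by (auto simp: set_mult_def)
  show "A <#> B \<subseteq> carrier G" using A_car B_car by (auto simp: set_mult_def)
  show "A <#> B \<noteq> {}" using I subgroup.one_closed[OF A] subgroup.one_closed[OF B_sub] by blast
  fix x assume "x \<in> A <#> B"
  then obtain a b where ab: "x = a \<otimes> b" "a \<in> A" "b \<in> B" by (auto simp: set_mult_def)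
  have "inv x = inv a \<otimes> (a \<otimes> inv b \<otimes> inv a)"
    using ab A_car B_car by (simp add: inv_mult_group m_assoc mult_inv_cancel)
  moreover have "inv a \<otimes> (a \<otimes> inv b \<otimes> inv a) \<in> A <#> B"
    by (intro I B_conj subgroup.m_inv_closed[OF A] subgroup.m_inv_closed[OF B_sub] ab A_car)
  ultimately show "inv x \<in> A <#> B" by simp
  fix y assume "y \<in> A <#> B"
  then obtain c d where cd: "y = c \<otimes> d" "c \<in> A" "d \<in> B" by (auto simp: set_mult_def)
  have "x \<otimes> y = (a \<otimes> c) \<otimes> ((inv c \<otimes> b \<otimes> inv (inv c)) \<otimes> d)"
    using ab cd A_car B_car by (simp add: m_assoc mult_inv_cancel)
  moreover have "(a \<otimes> c) \<otimes> ((inv c \<otimes> b \<otimes> inv (inv c)) \<otimes> d) \<in> A <#> B"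
    by (intro I B_conj subgroup.m_closed[OF A] subgroup.m_closed[OF B_sub] ab cd A_car inv_closed)
  ultimately show "x \<otimes> y \<in> A <#> B" by simp
qed

locale compact_group = group G for G (structure) +
  fixes T :: "'a topology"
  assumes topspace_T [simp]: "topspace T = carrier G"
    and mult_continuous: "continuous_map (prod_topology T T) T (\<lambda>(x, y). x \<otimes> y)"
    and inv_continuous: "continuous_map T T (\<lambda>x. inv x)"
    and compact_T: "compact_space T"
    and Hausdorff_T: "Hausdorff_space T"
begin

lemma continuous_mult:
  assumes "continuous_map X T f" "continuous_map X T g"
  shows "continuous_map X T (\<lambda>x. f x \<otimes> g x)"
proof -
  have "continuous_map X T ((\<lambda>(x, y). x \<otimes> y) \<circ> (\<lambda>x. (f x, g x)))"
    by (rule continuous_map_compose[OF _ mult_continuous]) (intro continuous_map_pairedI assms)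
  then show ?thesis by (simp add: o_def)
qed

lemma carrier_closed: "closedin T (carrier G)"
  using closedin_topspace[of T] by simp

lemma one_closedin: "closedin T {\<one>}"
  using Hausdorff_T by (simp add: closedin_Hausdorff_singleton)

lemma generated_closed_subgroup:
  assumes "A \<subseteq> carrier G"
  shows "subgroup (closed_subgroup_generated G T A) G" "closedin T (closed_subgroup_generated G T A)"
proof -
  let ?F = "{H. (subgroup H G \<and> closedin T H) \<and> A \<subseteq> H}"
  have ne: "?F \<noteq> {}" using assms subgroup_self carrier_closed by auto
  have eq: "closed_subgroup_generated G T A = \<Inter>?F"
    by (simp add: closed_subgroup_generated_def hull_def)
  show "subgroup (closed_subgroup_generated G T A) G" unfolding eq
    by (rule subgroups_Inter) (use ne in auto)
  show "closedin T (closed_subgroup_generated G T A)" unfolding eq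
    by (rule closedin_Inter) (use ne in auto)
qed

lemma generated_subset: "A \<subseteq> closed_subgroup_generated G T A"
  by (simp add: closed_subgroup_generated_def hull_subset)

lemma generated_minimal:
  "\<lbrakk>subgroup H G; closedin T H; A \<subseteq> H\<rbrakk> \<Longrightarrow> closed_subgroup_generated G T A \<subseteq> H"
  by (simp add: closed_subgroup_generated_def hull_minimal)

definition closed_normal :: "'a set \<Rightarrow> bool" where
  "closed_normal N \<longleftrightarrow> N \<lhd> G \<and> closedin T N"

lemma closed_normalD:
  assumes "closed_normal N"
  shows "N \<lhd> G" "subgroup N G" "closedin T N" "N \<subseteq> carrier G" "\<one> \<in> N"
  using assms normal_imp_subgroup[of N G] subgroup.subset[of N G] subgroup.one_closed[of N G]
  by (auto simp: closed_normal_def)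

text \<open>For fixed \<open>g\<close>, the elements whose conjugate by \<open>g\<close> stays in
  the generated group form a closed subgroup, as conjugation is continuous, and this subgroup
  contains \<open>A\<close>.\<close>

lemma generated_closed_normal:
  assumes "A \<subseteq> carrier G" "\<And>g x. \<lbrakk>g \<in> carrier G; x \<in> A\<rbrakk> \<Longrightarrow> g \<otimes> x \<otimes> inv g \<in> A"
  shows "closed_normal (closed_subgroup_generated G T A)"
proof -
  let ?C = "closed_subgroup_generated G T A"
  note C = generated_closed_subgroup[OF assms(1)]
  have "g \<otimes> x \<otimes> inv g \<in> ?C" if g: "g \<in> carrier G" and x: "x \<in> ?C" for g x
  proof -
    define K where "K = {x \<in> carrier G. g \<otimes> x \<otimes> inv g \<in> ?C}"
    have "subgroup K G"
    proof (rule subgroupI)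
      show "K \<noteq> {}" using g subgroup.one_closed[OF C(1)] by (auto simp: K_def intro!: exI[of _ \<one>])
      fix x assume x: "x \<in> K"
      have "inv (g \<otimes> x \<otimes> inv g) \<in> ?C"
        by (rule subgroup.m_inv_closed[OF C(1)]) (use x in \<open>simp add: K_def\<close>)
      then show "inv x \<in> K" using x g by (simp add: K_def inv_mult_group m_assoc)
      fix y assume y: "y \<in> K"
      have "(g \<otimes> x \<otimes> inv g) \<otimes> (g \<otimes> y \<otimes> inv g) \<in> ?C"
        by (rule subgroup.m_closed[OF C(1)]) (use x y in \<open>simp_all add: K_def\<close>)
      then show "x \<otimes> y \<in> K" using x y g by (simp add: K_def m_assoc mult_inv_cancel)
    qed (auto simp: K_def)
    moreover have "closedin T K"
    proof -
      have "continuous_map T T (\<lambda>x. g \<otimes> x \<otimes> inv g)"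
        using g by (intro continuous_mult) auto
      from closedin_continuous_map_preimage[OF this C(2)] show ?thesis by (simp add: K_def)
    qed
    moreover have "A \<subseteq> K" using assms g generated_subset[of A] by (auto simp: K_def)
    ultimately have "?C \<subseteq> K" by (rule generated_minimal)
    then show ?thesis using x by (auto simp: K_def)
  qed
  then show ?thesis using C by (auto simp: closed_normal_def normal_inv_iff)
qed

lemma closed_normal_carrier: "closed_normal (carrier G)"
  using subgroup_self carrier_closed by (auto simp: closed_normal_def normal_inv_iff)

lemma closed_normal_one: "closed_normal {\<one>}"
  using one_closedin triv_subgroup by (auto simp: closed_normal_def normal_inv_iff)

text \<open>The filtration is defined by plain products of sets. They stay closed because the
  product is the continuous image of the compact set \<open>A \<times> B\<close> in a Hausdorff
  space.\<close>

lemma closed_normal_set_mult: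
  assumes A: "closed_normal A" and B: "closed_normal B"
  shows "closed_normal (A <#> B)"
proof -
  note A' = closed_normalD[OF A] and B' = closed_normalD[OF B]
  have "subgroup (A <#> B) G" by (rule subgroup_set_mult_normal[OF A'(2) B'(1)])
  moreover have "g \<otimes> x \<otimes> inv g \<in> A <#> B" if g: "g \<in> carrier G" and x: "x \<in> A <#> B" for g x
  proof -
    obtain a b where ab: "x = a \<otimes> b" "a \<in> A" "b \<in> B" using x by (auto simp: set_mult_def)
    have "a \<in> carrier G" "b \<in> carrier G" using ab A'(4) B'(4) by auto
    then have "g \<otimes> x \<otimes> inv g = (g \<otimes> a \<otimes> inv g) \<otimes> (g \<otimes> b \<otimes> inv g)"
      using g ab by (simp add: m_assoc mult_inv_cancel)
    moreover have "g \<otimes> a \<otimes> inv g \<in> A" "g \<otimes> b \<otimes> inv g \<in> B"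
      using g ab A'(1) B'(1) by (auto simp: normal_inv_iff)
    ultimately show ?thesis by (auto simp: set_mult_def)
  qed
  moreover have "closedin T (A <#> B)"
  proof (rule compactin_imp_closedin[OF Hausdorff_T])
    have "compactin (prod_topology T T) (A \<times> B)"
      using A'(3) B'(3) closedin_compact_space[OF compact_T] by (simp add: compactin_Times)
    from image_compactin[OF this mult_continuous]
    have "compactin T ((\<lambda>(x, y). x \<otimes> y) ` (A \<times> B))" .
    also have "(\<lambda>(x, y). x \<otimes> y) ` (A \<times> B) = A <#> B" by (auto simp: set_mult_def)
    finally show "compactin T (A <#> B)" .
  qed
  ultimately show ?thesis by (auto simp: closed_normal_def normal_inv_iff)
qed

lemma conj_pow:
  assumes "g \<in> carrier G" "x \<in> carrier G"
  shows "g \<otimes> x [^] (k::nat) \<otimes> inv g = (g \<otimes> x \<otimes> inv g) [^] k"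
proof (induction k)
  case (Suc k)
  have "(g \<otimes> x \<otimes> inv g) [^] Suc k = g \<otimes> x [^] k \<otimes> inv g \<otimes> (g \<otimes> x \<otimes> inv g)"
    using Suc by simp
  then show ?case using assms by (simp add: m_assoc mult_inv_cancel)
qed (use assms in simp)

lemma closed_normal_power:
  assumes "closed_normal A"
  shows "closed_normal (closed_power G T A k)"
  unfolding closed_power_def
proof (rule generated_closed_normal)
  note A = closed_normalD[OF assms]
  show "{\<sigma> [^] k |\<sigma>. \<sigma> \<in> A} \<subseteq> carrier G" using A(4) by auto
  fix g x assume g: "g \<in> carrier G" and "x \<in> {\<sigma> [^] k |\<sigma>. \<sigma> \<in> A}"
  then obtain s where s: "x = s [^] k" "s \<in> A" by auto
  have "s \<in> carrier G" using s A(4) by auto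
  moreover have "g \<otimes> s \<otimes> inv g \<in> A" using g s A(1) by (auto simp: normal_inv_iff)
  ultimately show "g \<otimes> x \<otimes> inv g \<in> {\<sigma> [^] k |\<sigma>. \<sigma> \<in> A}"
    using s g by (auto simp: conj_pow)
qed

lemma closed_normal_commutator:
  assumes "closed_normal A" "closed_normal B"
  shows "closed_normal (closed_commutator G T A B)"
  unfolding closed_commutator_def
proof (rule generated_closed_normal)
  note A = closed_normalD[OF assms(1)] and B = closed_normalD[OF assms(2)]
  let ?C = "{inv \<sigma> \<otimes> inv \<tau> \<otimes> \<sigma> \<otimes> \<tau> |\<sigma> \<tau>. \<sigma> \<in> A \<and> \<tau> \<in> B}"
  show "?C \<subseteq> carrier G"
  proof
    fix x assume "x \<in> ?C"
    then obtain s t where "x = inv s \<otimes> inv t \<otimes> s \<otimes> t" "s \<in> A" "t \<in> B" by auto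
    moreover have "s \<in> carrier G" "t \<in> carrier G" using calculation A(4) B(4) by auto
    ultimately show "x \<in> carrier G" by simp
  qed
  fix g x assume g: "g \<in> carrier G" and "x \<in> ?C"
  then obtain s t where st: "x = inv s \<otimes> inv t \<otimes> s \<otimes> t" "s \<in> A" "t \<in> B" by auto
  define s' where "s' = g \<otimes> s \<otimes> inv g"
  define t' where "t' = g \<otimes> t \<otimes> inv g"
  have "s \<in> carrier G" "t \<in> carrier G" using st A(4) B(4) by auto
  then have "g \<otimes> x \<otimes> inv g = inv s' \<otimes> inv t' \<otimes> s' \<otimes> t'"
    using g by (simp add: st s'_def t'_def m_assoc mult_inv_cancel inv_mult_group)
  moreover have "s' \<in> A" "t' \<in> B" using g st A(1) B(1) by (auto simp: normal_inv_iff s'_def t'_def)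
  ultimately show "g \<otimes> x \<otimes> inv g \<in> ?C" by blast
qed

lemma closed_normal_foldr:
  "(\<And>i. i \<in> set is \<Longrightarrow> closed_normal (C i)) \<Longrightarrow> closed_normal (foldr (\<lambda>i A. C i <#> A) is {\<one>})"
  by (induction "is") (auto intro: closed_normal_one closed_normal_set_mult)

lemma subset_set_mult_left: "\<lbrakk>A \<subseteq> carrier G; \<one> \<in> B\<rbrakk> \<Longrightarrow> A \<subseteq> A <#> B"
proof
  fix a assume "A \<subseteq> carrier G" "\<one> \<in> B" "a \<in> A"
  then have "a \<otimes> \<one> \<in> A <#> B" unfolding set_mult_def by blast
  with \<open>a \<in> A\<close> \<open>A \<subseteq> carrier G\<close> show "a \<in> A <#> B" by (simp add: subset_iff)
qed

lemma subset_set_mult_right: "\<lbrakk>B \<subseteq> carrier G; \<one> \<in> A\<rbrakk> \<Longrightarrow> B \<subseteq> A <#> B"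
proof
  fix b assume "B \<subseteq> carrier G" "\<one> \<in> A" "b \<in> B"
  then have "\<one> \<otimes> b \<in> A <#> B" unfolding set_mult_def by blast
  with \<open>b \<in> B\<close> \<open>B \<subseteq> carrier G\<close> show "b \<in> A <#> B" by (simp add: subset_iff)
qed

lemma set_mult_subset: "\<lbrakk>subgroup H G; A \<subseteq> H; B \<subseteq> H\<rbrakk> \<Longrightarrow> A <#> B \<subseteq> H"
  unfolding set_mult_def using subgroup.m_closed[of H G] by blast

lemma foldr_set_mult_subset:
  assumes "subgroup H G" "\<And>i. i \<in> set is \<Longrightarrow> C i \<subseteq> H"
  shows "foldr (\<lambda>i A. C i <#> A) is {\<one>} \<subseteq> H"
  using assms(2)
proof (induction "is")
  case (Cons j js)
  then show ?case by (simp add: set_mult_subset[OF assms(1)])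
qed (use subgroup.one_closed[OF assms(1)] in simp)

lemma subset_foldr_set_mult:
  assumes "\<And>i. i \<in> set is \<Longrightarrow> closed_normal (C i)" "i \<in> set is"
  shows "C i \<subseteq> foldr (\<lambda>i A. C i <#> A) is {\<one>}"
  using assms
proof (induction "is")
  case (Cons j js)
  have js: "closed_normal (foldr (\<lambda>i A. C i <#> A) js {\<one>})"
    by (rule closed_normal_foldr) (use Cons in auto)
  have j: "closed_normal (C j)" using Cons by auto
  show ?case
  proof (cases "i = j")
    case True
    then show ?thesis
      using subset_set_mult_left[OF closed_normalD(4)[OF j] closed_normalD(5)[OF js]] by simp
  next
    case False
    then have "C i \<subseteq> foldr (\<lambda>i A. C i <#> A) js {\<one>}" using Cons by auto
    also have "\<dots> \<subseteq> C j <#> foldr (\<lambda>i A. C i <#> A) js {\<one>}"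
      by (rule subset_set_mult_right[OF closed_normalD(4)[OF js] closed_normalD(5)[OF j]])
    finally show ?thesis by simp
  qed
qed simp

end

text \<open>The upper bound drives inductions along the recursion; the last inequality puts
  \<open>p\<close>-th powers taken at the rounded index into the \<open>n\<close>-th term of any
  descending series that satisfies the power law.\<close>

lemma ceiling_div_bounds:
  assumes "n \<ge> 2" "p \<ge> 2"
  shows "nat \<lceil>real n / real p\<rceil> < n" "0 < nat \<lceil>real n / real p\<rceil>" "n \<le> nat \<lceil>real n / real p\<rceil> * p"
proof -
  have "real n / real p \<le> real n / 2"
    by (intro divide_left_mono) (use assms in auto)
  with assms have "real n / real p \<le> real (n - 1)" by linarith
  then have "\<lceil>real n / real p\<rceil> \<le> int (n - 1)" by (simp add: ceiling_le_iff)
  with assms show "nat \<lceil>real n / real p\<rceil> < n" by simp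
  show pos: "0 < nat \<lceil>real n / real p\<rceil>" using assms by simp
  define m where "m = nat \<lceil>real n / real p\<rceil>"
  have "real n / real p \<le> real m" unfolding m_def by (rule real_nat_ceiling_ge)
  then have "real n / real p * real p \<le> real m * real p" by (rule mult_right_mono) simp
  then have "real n \<le> real (m * p)" using assms by simp
  then have "n \<le> m * p" by (rule of_nat_le_iff[THEN iffD1])
  then show "n \<le> nat \<lceil>real n / real p\<rceil> * p" by (simp add: m_def)
qed

section \<open>The Zassenhaus filtration as the least restricted series of closed subgroups\<close>

context compact_group
begin

context
  fixes p :: nat
  assumes p2: "p \<ge> 2"
begin

abbreviation (input) Z where "Z n \<equiv> zassenhaus p G T n"

lemma zassenhaus_1: "n < 2 \<Longrightarrow> Z n = carrier G"
  by (simp add: zassenhaus.simps)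

lemma zassenhaus_rec:
  "n \<ge> 2 \<Longrightarrow> Z n = closed_power G T (Z (nat \<lceil>real n / real p\<rceil>)) p <#>
     foldr (\<lambda>i A. closed_commutator G T (Z i) (Z (n - i)) <#> A) [1..<n] {\<one>}"
  using p2 by (subst zassenhaus.simps) auto

lemma zassenhaus_closed_normal: "closed_normal (Z n)"
proof (induction n rule: less_induct)
  case (less n)
  show ?case
  proof (cases "n < 2")
    case True
    then show ?thesis by (simp add: zassenhaus_1 closed_normal_carrier)
  next
    case False
    then have n: "n \<ge> 2" by simp
    show ?thesis unfolding zassenhaus_rec[OF n]
      using ceiling_div_bounds(1)[OF n p2]
      by (intro closed_normal_set_mult closed_normal_power closed_normal_foldr closed_normal_commutator less) auto
  qed
qed

lemma closed_normal_zassenhaus_factors: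
  "closed_normal (closed_power G T (Z m) p)"
  "closed_normal (foldr (\<lambda>i A. closed_commutator G T (Z i) (Z (n - i)) <#> A) [1..<n] {\<one>})"
  by (intro closed_normal_power closed_normal_foldr closed_normal_commutator zassenhaus_closed_normal)+

lemma zassenhaus_pow:
  assumes "i > 0" "x \<in> Z i"
  shows "x [^] p \<in> Z (i * p)"
proof -
  have ip: "i * p \<ge> 2" using mult_le_mono[of 1 i 2 p] assms p2 by simp
  have "x [^] p \<in> {\<sigma> [^] p |\<sigma>. \<sigma> \<in> Z i}" using assms(2) by blast
  then have "x [^] p \<in> closed_power G T (Z i) p"
    unfolding closed_power_def by (rule subsetD[OF generated_subset])
  also have "i = nat \<lceil>real (i * p) / real p\<rceil>" using p2 by simp
  finally have "x [^] p \<in> closed_power G T (Z (nat \<lceil>real (i * p) / real p\<rceil>)) p" .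
  also have "\<dots> \<subseteq> Z (i * p)" unfolding zassenhaus_rec[OF ip]
    by (intro subset_set_mult_left closed_normalD closed_normal_zassenhaus_factors)
  finally show ?thesis .
qed

lemma commutator_in_closed_commutator:
  "\<lbrakk>x \<in> A; y \<in> B\<rbrakk> \<Longrightarrow> inv x \<otimes> inv y \<otimes> x \<otimes> y \<in> closed_commutator G T A B"
  unfolding closed_commutator_def by (rule subsetD[OF generated_subset]) blast

lemma closed_commutator_subset_zassenhaus:
  assumes "0 < i" "i < n"
  shows "closed_commutator G T (Z i) (Z (n - i)) \<subseteq> Z n"
proof -
  have n: "n \<ge> 2" using assms by simp
  have "closed_commutator G T (Z i) (Z (n - i))
      \<subseteq> foldr (\<lambda>i A. closed_commutator G T (Z i) (Z (n - i)) <#> A) [1..<n] {\<one>}"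
    by (rule subset_foldr_set_mult) (use assms in \<open>auto intro: closed_normal_commutator zassenhaus_closed_normal\<close>)
  also have "\<dots> \<subseteq> Z n" unfolding zassenhaus_rec[OF n]
    by (intro subset_set_mult_right closed_normalD closed_normal_zassenhaus_factors)
  finally show ?thesis .
qed

lemma zassenhaus_comm:
  assumes "i > 0" "j > 0" "x \<in> Z i" "y \<in> Z j"
  shows "inv x \<otimes> inv y \<otimes> x \<otimes> y \<in> Z (i + j)"
  using commutator_in_closed_commutator[OF assms(3,4)] closed_commutator_subset_zassenhaus[of i "i + j"] assms
  by auto

lemma closed_commutator_mono:
  "\<lbrakk>A \<subseteq> A'; B \<subseteq> B'\<rbrakk> \<Longrightarrow> closed_commutator G T A B \<subseteq> closed_commutator G T A' B'"
  unfolding closed_commutator_def closed_subgroup_generated_def by (rule hull_mono) blast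

lemma closed_power_mono: "A \<subseteq> A' \<Longrightarrow> closed_power G T A k \<subseteq> closed_power G T A' k"
  unfolding closed_power_def closed_subgroup_generated_def by (rule hull_mono) blast

text \<open>By induction the generators of all factors of \<open>Z n\<close> lie in the closed
  subgroup \<open>D n\<close>. This minimality is what transports the flag filtration of a
  representation to \<open>Z\<close>.\<close>

lemma zassenhaus_least:
  assumes D: "\<And>i. subgroup (D i) G" "\<And>i. closedin T (D i)" "D (Suc 0) = carrier G" "\<And>i j. i \<le> j \<Longrightarrow> D j \<subseteq> D i"
    and D_comm: "\<And>i j x y. \<lbrakk>0 < i; 0 < j; x \<in> D i; y \<in> D j\<rbrakk> \<Longrightarrow> inv x \<otimes> inv y \<otimes> x \<otimes> y \<in> D (i + j)"
    and D_pow: "\<And>i x. \<lbrakk>0 < i; x \<in> D i\<rbrakk> \<Longrightarrow> x [^] p \<in> D (i * p)"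
    and "n > 0"
  shows "Z n \<subseteq> D n"
  using \<open>n > 0\<close>
proof (induction n rule: less_induct)
  case (less n)
  show ?case
  proof (cases "n = 1")
    case True
    then show ?thesis using D(3) by (simp add: zassenhaus_1)
  next
    case False
    then have n: "n \<ge> 2" using less.prems by simp
    let ?m = "nat \<lceil>real n / real p\<rceil>"
    note m = ceiling_div_bounds[OF n p2]
    have "\<sigma> [^] p \<in> D n" if "\<sigma> \<in> Z ?m" for \<sigma>
      using D_pow[OF m(2), of \<sigma>] less.IH[OF m(1,2)] D(4)[OF m(3)] that by auto
    then have "closed_power G T (Z ?m) p \<subseteq> D n"
      unfolding closed_power_def by (intro generated_minimal D) auto
    moreover have "closed_commutator G T (Z i) (Z (n - i)) \<subseteq> D n" if "i \<in> set [1..<n]" for i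
    proof -
      have i: "0 < i" "i < n" using that by auto
      have "inv x \<otimes> inv y \<otimes> x \<otimes> y \<in> D n" if "x \<in> Z i" "y \<in> Z (n - i)" for x y
        using D_comm[of i "n - i" x y] less.IH[of i] less.IH[of "n - i"] i that by auto
      then show ?thesis unfolding closed_commutator_def by (intro generated_minimal D) blast
    qed
    ultimately show ?thesis unfolding zassenhaus_rec[OF n]
      by (intro set_mult_subset foldr_set_mult_subset D)
  qed
qed

text \<open>Descent is not built into the recursion and is proved factor by factor. Rounding up is
  monotone, and a commutator factor of \<open>Z (Suc n)\<close> is enlarged to one of
  \<open>Z n\<close> by lowering one of its two indices: the second if \<open>i = 1\<close>, the
  first otherwise.\<close>

lemma zassenhaus_Suc: "Z (Suc n) \<subseteq> Z n"
proof (induction n rule: less_induct)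
  case (less n)
  have anti: "Z j \<subseteq> Z i" if "i \<le> j" "j \<le> n" for i j
    using that
  proof (induction j rule: dec_induct)
    case (step k)
    then show ?case using less.IH[of k] by auto
  qed simp
  show ?case
  proof (cases "n < 2")
    case True
    then show ?thesis using closed_normalD(4)[OF zassenhaus_closed_normal] by (simp add: zassenhaus_1)
  next
    case False
    then have n: "n \<ge> 2" "Suc n \<ge> 2" by simp_all
    note sub = closed_normalD(2)[OF zassenhaus_closed_normal]
    let ?m = "\<lambda>n. nat \<lceil>real n / real p\<rceil>"
    have m: "?m n \<le> ?m (Suc n)" by (intro nat_mono ceiling_mono divide_right_mono) auto
    have "Z (?m (Suc n)) \<subseteq> Z (?m n)"
      by (rule anti[OF m]) (use ceiling_div_bounds(1)[OF n(2) p2] in linarith)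
    then have "closed_power G T (Z (?m (Suc n))) p \<subseteq> closed_power G T (Z (?m n)) p"
      by (rule closed_power_mono)
    also have "\<dots> \<subseteq> Z n" unfolding zassenhaus_rec[OF n(1)]
      by (intro subset_set_mult_left closed_normalD closed_normal_zassenhaus_factors)
    finally have "closed_power G T (Z (?m (Suc n))) p \<subseteq> Z n" .
    moreover have "closed_commutator G T (Z i) (Z (Suc n - i)) \<subseteq> Z n" if "i \<in> set [1..<Suc n]" for i
    proof (cases "i = 1")
      case True
      have "closed_commutator G T (Z i) (Z (Suc n - i)) \<subseteq> closed_commutator G T (Z 1) (Z (n - 1))"
        using True anti[of "n - 1" n] by (intro closed_commutator_mono) auto
      also have "\<dots> \<subseteq> Z n" using n by (intro closed_commutator_subset_zassenhaus) auto
      finally show ?thesis .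
    next
      case False
      then have i: "2 \<le> i" "i \<le> n" using that by auto
      have "closed_commutator G T (Z i) (Z (Suc n - i)) \<subseteq> closed_commutator G T (Z (i - 1)) (Z (n - (i - 1)))"
        using i anti[of "i - 1" i] by (intro closed_commutator_mono) (auto simp: Suc_diff_le)
      also have "\<dots> \<subseteq> Z n" using i by (intro closed_commutator_subset_zassenhaus) auto
      finally show ?thesis .
    qed
    ultimately show ?thesis unfolding zassenhaus_rec[OF n(2)]
      by (intro set_mult_subset foldr_set_mult_subset sub)
  qed
qed

end

end

text \<open>Membership is read off in the quotient by \<open>N\<close>, so relations between
  representatives in \<open>A\<close> transfer to elements of \<open>A <#> N\<close>.\<close>

lemma (in group) mem_set_mult_normal_iff:
  assumes N: "N \<lhd> G" and A: "A \<subseteq> carrier G" and x: "x \<in> carrier G"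
  shows "x \<in> A <#> N \<longleftrightarrow> (\<exists>a\<in>A. N #> x = N #> a)"
proof
  have N': "subgroup N G" using N by (rule normal_imp_subgroup)
  assume "x \<in> A <#> N"
  then obtain a h where *: "x = a \<otimes> h" "a \<in> A" "h \<in> N" by (auto simp: set_mult_def)
  then have "x \<in> a <# N" by (auto simp: l_coset_def)
  also have "a <# N = N #> a" using normal.coset_eq[OF N] * A by auto
  finally have "N #> a = N #> x" using * A N' by (intro repr_independence) auto
  then show "\<exists>a\<in>A. N #> x = N #> a" using * by auto
next
  have N': "subgroup N G" using N by (rule normal_imp_subgroup)
  assume "\<exists>a\<in>A. N #> x = N #> a"
  then obtain a where a: "a \<in> A" "N #> x = N #> a" by auto
  have "x \<in> N #> a" using rcos_self[OF x N'] a by simp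
  also have "N #> a = a <# N" using normal.coset_eq[OF N] a A by auto
  finally show "x \<in> A <#> N" using a by (auto simp: l_coset_def set_mult_def)
qed

lemma (in group) finite_rcosets_mono:
  assumes "finite (rcosets N)" "subgroup N G" "subgroup H G" "N \<subseteq> H"
  shows "finite (rcosets H)"
proof (rule finite_surj[OF assms(1)])
  show "rcosets H \<subseteq> (\<lambda>C. H <#> C) ` (rcosets N)"
  proof
    fix D assume "D \<in> rcosets H"
    then obtain x where x: "x \<in> carrier G" "D = H #> x" by (auto simp: RCOSETS_def)
    note car = subgroup.mem_carrier[OF assms(3)] subgroup.mem_carrier[OF assms(2)]
    have "H #> x \<subseteq> H <#> (N #> x)"
    proof
      fix y assume "y \<in> H #> x"
      then obtain h where h: "h \<in> H" "y = h \<otimes> x" by (auto simp: r_coset_def)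
      then have "y = h \<otimes> (\<one> \<otimes> x)" using x by simp
      then show "y \<in> H <#> (N #> x)"
        using h subgroup.one_closed[OF assms(2)] unfolding set_mult_def r_coset_def by blast
    qed
    moreover have "H <#> (N #> x) \<subseteq> H #> x"
    proof
      fix y assume "y \<in> H <#> (N #> x)"
      then obtain h k where h: "h \<in> H" "k \<in> N" "y = h \<otimes> (k \<otimes> x)" by (auto simp: r_coset_def set_mult_def)
      then have "y = (h \<otimes> k) \<otimes> x" "h \<otimes> k \<in> H"
        using x car assms(4) subgroup.m_closed[OF assms(3)] by (auto simp: m_assoc)
      then show "y \<in> H #> x" unfolding r_coset_def by blast
    qed
    ultimately have "D = H <#> (N #> x)" using x by simp
    then show "D \<in> (\<lambda>C. H <#> C) ` (rcosets N)" using x by (auto simp: RCOSETS_def)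
  qed
qed

section \<open>The filtration modulo a normal subgroup, and separation by open normal
  subgroups\<close>

context compact_group
begin

lemma restricted_series_zassenhaus:
  assumes p: "prime p" and N: "N \<lhd> G"
  shows "restricted_series G (\<lambda>i. zassenhaus p G T i <#> N) p"
proof -
  note p2 = prime_ge_2_nat[OF p]
  let ?Z = "zassenhaus p G T"
  note Z = closed_normalD[OF zassenhaus_closed_normal[OF p2]]
  interpret q: group_hom G "G Mod N" "\<lambda>x. N #> x"
    using normal.r_coset_hom_Mod[OF N] normal.factorgroup_is_group[OF N]
    by (intro group_hom.intro group_hom_axioms.intro group_axioms)
  have sub: "subgroup (?Z i <#> N) G" for i by (rule subgroup_set_mult_normal[OF Z(2) N])
  note mem_iff = mem_set_mult_normal_iff[OF N Z(4)]
  have D: "x \<in> carrier G \<and> (\<exists>a\<in>?Z i. a \<in> carrier G \<and> N #> x = N #> a)" if "x \<in> ?Z i <#> N" for x i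
  proof -
    have "x \<in> carrier G" using that subgroup.subset[OF sub] by blast
    then show ?thesis using that mem_iff[of x i] Z(4)[of i] by auto
  qed
  show ?thesis
  proof (intro restricted_series.intro restricted_series_axioms.intro group_axioms p sub)
    show "?Z (Suc 0) <#> N = carrier G"
      using set_mult_carrier_idem[OF normal_imp_subgroup[OF N]] by (simp add: zassenhaus_1[OF p2])
  next
    fix i show "?Z (Suc i) <#> N \<subseteq> ?Z i <#> N"
      by (intro mono_set_mult zassenhaus_Suc[OF p2] order_refl)
  next
    fix i j x y assume *: "i > 0" "j > 0" "x \<in> ?Z i <#> N" "y \<in> ?Z j <#> N"
    obtain a where a: "a \<in> ?Z i" "a \<in> carrier G" "x \<in> carrier G" "N #> x = N #> a" using D[OF *(3)] by blast
    obtain b where b: "b \<in> ?Z j" "b \<in> carrier G" "y \<in> carrier G" "N #> y = N #> b" using D[OF *(4)] by blast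
    have c: "inv x \<otimes> inv y \<otimes> x \<otimes> y \<in> carrier G" using a b by simp
    have "N #> (inv x \<otimes> inv y \<otimes> x \<otimes> y) = N #> (inv a \<otimes> inv b \<otimes> a \<otimes> b)"
      using a b by (simp only: q.hom_mult q.hom_inv m_closed inv_closed)
    then show "inv x \<otimes> inv y \<otimes> x \<otimes> y \<in> ?Z (i + j) <#> N"
      unfolding mem_iff[OF c] using zassenhaus_comm[OF p2 *(1,2) a(1) b(1)] by blast
  next
    fix i x assume *: "i > 0" "x \<in> ?Z i <#> N"
    obtain a where a: "a \<in> ?Z i" "a \<in> carrier G" "x \<in> carrier G" "N #> x = N #> a" using D[OF *(2)] by blast
    have c: "x [^] p \<in> carrier G" using a by simp
    have "N #> (x [^] p) = N #> (a [^] p)"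
      using a by (simp only: q.hom_nat_pow)
    then show "x [^] p \<in> ?Z (i * p) <#> N"
      unfolding mem_iff[OF c] using zassenhaus_pow[OF p2 *(1) a(1)] by blast
  qed
qed

text \<open>In a compact Hausdorff space a connected component and a closed set disjoint from it are
  separated by a clopen partition; total disconnectedness makes the component of \<open>s\<close> a
  singleton.\<close>

lemma clopen_separation:
  assumes td: "totally_disconnected_space T" and C: "closedin T C" and s: "s \<in> carrier G" "s \<notin> C"
  obtains U V where "closedin T U" "closedin T V" "U \<union> V = carrier G" "U \<inter> V = {}" "s \<in> U" "C \<subseteq> V"
proof -
  have "connected_component_of_set T s = {s}"
  proof -
    have "connectedin T (connected_component_of_set T s)" by (rule connectedin_connected_component_of)
    moreover have "s \<in> connected_component_of_set T s" using s by (simp add: connected_component_of_refl)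
    ultimately show ?thesis using td unfolding totally_disconnected_space_def by blast
  qed
  then have "{s} \<in> connected_components_of T"
    using s by (auto simp: connected_components_of_def image_iff intro!: bexI[of _ s])
  then have "separated_between T {s} C"
    using s C Hausdorff_T compact_T
    by (intro separated_between_compact_connected_component compact_imp_locally_compact_space)
       (auto simp: finite_imp_compactin)
  then obtain U V where "openin T U" "openin T V" "U \<union> V = carrier G" "disjnt U V" "{s} \<subseteq> U" "C \<subseteq> V"
    by (auto simp: separated_between_def)
  moreover have "closedin T U" "closedin T V"
  proof -
    have "U = topspace T - V" "V = topspace T - U" using calculation by (auto simp: disjnt_def)
    then show "closedin T U" "closedin T V" using calculation by (metis openin_closedin_eq openin_diff openin_topspace closedin_diff closedin_topspace)+
  qed
  ultimately show ?thesis using that[of U V] by (auto simp: disjnt_def)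
qed

text \<open>
  The elements that may be deleted from any product without affecting its membership in a
  clopen set \<open>U\<close> form a normal subgroup, which is open by compactness.
\<close>
lemma open_normal_separation:
  assumes "totally_disconnected_space T" "closedin T C" "s \<in> carrier G" "s \<notin> C"
  obtains N where "N \<lhd> G" "openin T N" "\<And>x. x \<in> N \<Longrightarrow> s \<otimes> x \<notin> C"
proof -
  obtain U V where UV: "closedin T U" "closedin T V" "U \<union> V = carrier G" "U \<inter> V = {}" "s \<in> U" "C \<subseteq> V"
    using clopen_separation[OF assms] by blast
  define N where "N = {x \<in> carrier G. \<forall>a\<in>carrier G. \<forall>b\<in>carrier G. a \<otimes> x \<otimes> b \<in> U \<longleftrightarrow> a \<otimes> b \<in> U}"
  have N_D: "a \<otimes> x \<otimes> b \<in> U \<longleftrightarrow> a \<otimes> b \<in> U" if "x \<in> N" "a \<in> carrier G" "b \<in> carrier G" for x a b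
    using that by (simp add: N_def)
  have N_car: "x \<in> carrier G" if "x \<in> N" for x using that by (simp add: N_def)
  have "subgroup N G"
  proof (rule subgroupI)
    show "N \<subseteq> carrier G" using N_car by auto
    have "\<one> \<in> N" by (simp add: N_def)
    then show "N \<noteq> {}" by auto
  next
    fix x assume x: "x \<in> N"
    have "a \<otimes> inv x \<otimes> b \<in> U \<longleftrightarrow> a \<otimes> b \<in> U" if "a \<in> carrier G" "b \<in> carrier G" for a b
      using N_D[OF x, of "a \<otimes> inv x" b] that N_car[OF x] by (simp add: m_assoc)
    then show "inv x \<in> N" using N_car[OF x] by (simp add: N_def)
    fix y assume y: "y \<in> N"
    have "a \<otimes> (x \<otimes> y) \<otimes> b \<in> U \<longleftrightarrow> a \<otimes> b \<in> U" if "a \<in> carrier G" "b \<in> carrier G" for a b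
      using N_D[OF x, of a "y \<otimes> b"] N_D[OF y, of a b] that N_car[OF x] N_car[OF y] by (simp add: m_assoc)
    then show "x \<otimes> y \<in> N" using N_car[OF x] N_car[OF y] by (simp add: N_def)
  qed
  moreover have "g \<otimes> x \<otimes> inv g \<in> N" if g: "g \<in> carrier G" and x: "x \<in> N" for g x
  proof -
    have "a \<otimes> (g \<otimes> x \<otimes> inv g) \<otimes> b \<in> U \<longleftrightarrow> a \<otimes> b \<in> U" if "a \<in> carrier G" "b \<in> carrier G" for a b
      using N_D[OF x, of "a \<otimes> g" "inv g \<otimes> b"] that g N_car[OF x] by (simp add: m_assoc mult_inv_cancel)
    then show ?thesis using g N_car[OF x] by (simp add: N_def)
  qed
  ultimately have "N \<lhd> G" by (auto simp: normal_inv_iff)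
  moreover have "openin T N"
  proof -
    let ?Y = "prod_topology T T"
    let ?X = "prod_topology T ?Y"
    define f where "f = (\<lambda>q. fst (snd q) \<otimes> fst q \<otimes> snd (snd q))"
    define g where "g = (\<lambda>q :: 'a \<times> 'a \<times> 'a. fst (snd q) \<otimes> snd (snd q))"
    have cont: "continuous_map ?X T fst" "continuous_map ?X T (\<lambda>q. fst (snd q))" "continuous_map ?X T (\<lambda>q. snd (snd q))"
      using continuous_map_compose[OF continuous_map_snd continuous_map_fst]
        continuous_map_compose[OF continuous_map_snd continuous_map_snd]
      by (auto simp: o_def continuous_map_fst)
    have f: "continuous_map ?X T f" and g: "continuous_map ?X T g"
      unfolding f_def g_def by (intro continuous_mult cont)+
    \<comment> \<open>The triples \<open>(x, a, b)\<close> for which deleting \<open>x\<close> from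
      \<open>a \<otimes> x \<otimes> b\<close> changes membership in \<open>U\<close>. As
      \<open>U\<close> and \<open>V\<close> are closed, so is \<open>B\<close>; its projection along
      a compact factor is closed and is the complement of \<open>N\<close>.\<close>
    define B where "B = {q \<in> topspace ?X. f q \<in> U} \<inter> {q \<in> topspace ?X. g q \<in> V}
      \<union> {q \<in> topspace ?X. f q \<in> V} \<inter> {q \<in> topspace ?X. g q \<in> U}"
    have "closedin ?X B"
      unfolding B_def by (intro closedin_Un closedin_Int closedin_continuous_map_preimage[OF f]
        closedin_continuous_map_preimage[OF g] UV(1,2))
    moreover have "closed_map ?X T fst"
      by (rule Abstract_Topological_Spaces.closed_map_fst) (simp add: compact_space_prod_topology compact_T)
    ultimately have "closedin T (fst ` B)" by (simp add: closed_map_def)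
    moreover have "N = topspace T - fst ` B"
    proof -
      have V: "x \<in> V \<longleftrightarrow> x \<notin> U" if "x \<in> carrier G" for x using that UV(3,4) by auto
      have fg: "f q \<in> carrier G" "g q \<in> carrier G" if "q \<in> topspace ?X" for q
        using that by (auto simp: f_def g_def)
      have "x \<in> fst ` B \<longleftrightarrow> x \<notin> N" if x: "x \<in> carrier G" for x
      proof
        assume "x \<in> fst ` B"
        then obtain q where q: "q \<in> B" "x = fst q" by auto
        then have q': "q \<in> topspace ?X" by (auto simp: B_def)
        have "f q \<in> U \<longleftrightarrow> g q \<notin> U" using q(1) V[OF fg(1)[OF q']] V[OF fg(2)[OF q']] by (auto simp: B_def)
        then show "x \<notin> N"
          using N_D[of x "fst (snd q)" "snd (snd q)"] q' q(2) by (auto simp: f_def g_def)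
      next
        assume "x \<notin> N"
        then obtain a b where ab: "a \<in> carrier G" "b \<in> carrier G" "\<not> (a \<otimes> x \<otimes> b \<in> U \<longleftrightarrow> a \<otimes> b \<in> U)"
          using x by (auto simp: N_def)
        have q: "(x, a, b) \<in> topspace ?X" using ab x by simp
        have "(x, a, b) \<in> B"
          using ab q V[OF fg(1)[OF q]] V[OF fg(2)[OF q]] by (simp add: B_def f_def g_def)
        then show "x \<in> fst ` B" by force
      qed
      then show ?thesis using N_car by auto
    qed
    ultimately show ?thesis by (metis openin_diff openin_topspace)
  qed
  moreover have "s \<otimes> x \<notin> C" if x: "x \<in> N" for x
  proof -
    have "s \<otimes> x \<in> U" using N_D[OF x assms(3) one_closed] UV(5) assms(3) N_car[OF x] by simp
    then show ?thesis using UV by auto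
  qed
  ultimately show ?thesis using that by blast
qed

text \<open>The complement contains with each \<open>x\<close> the translate of \<open>K\<close> by
  \<open>x\<close>, an open neighbourhood of \<open>x\<close>.\<close>

lemma open_subgroup_closedin:
  assumes Y: "subgroup Y G" and K: "openin T K" "\<one> \<in> K" "K \<subseteq> Y"
  shows "closedin T Y"
proof -
  note Yc = subgroup.mem_carrier[OF Y]
  have "openin T (carrier G - Y)"
  proof (subst openin_subopen, intro ballI)
    fix x assume x: "x \<in> carrier G - Y"
    let ?W = "{y \<in> topspace T. inv x \<otimes> y \<in> K}"
    have "continuous_map T T (\<lambda>y. inv x \<otimes> y)"
      using x by (intro continuous_mult) auto
    then have "openin T ?W" using K(1) by (rule openin_continuous_map_preimage)
    moreover have "x \<in> ?W" using x K by simp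
    moreover have "?W \<subseteq> carrier G - Y"
    proof
      fix y assume y: "y \<in> ?W"
      have "y \<notin> Y"
      proof
        assume "y \<in> Y"
        moreover have "inv x \<otimes> y \<in> Y" using y K by auto
        ultimately have "y \<otimes> inv (inv x \<otimes> y) \<in> Y" using subgroup.m_closed[OF Y] subgroup.m_inv_closed[OF Y] by blast
        then show False using x y by (simp add: inv_mult_group mult_inv_cancel)
      qed
      then show "y \<in> carrier G - Y" using y by simp
    qed
    ultimately show "\<exists>W. openin T W \<and> x \<in> W \<and> W \<subseteq> carrier G - Y" by blast
  qed
  then show ?thesis using subgroup.subset[OF Y] by (simp add: closedin_def)
qed

end

section \<open>Separation by representations of a free pro-\<open>p\<close> group\<close>

lemma profinite_imp_compact_group:
  "profinite_group G T \<Longrightarrow> compact_group G T"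
  by (auto simp: profinite_group_def topological_group_def intro!: compact_group.intro compact_group_axioms.intro)

lemma pro_p_finite_index:
  assumes "pro_p_group p G T" "prime p" "N \<lhd> G" "openin T N"
  shows "finite (rcosets\<^bsub>G\<^esub> N)"
proof -
  obtain k where "card (rcosets\<^bsub>G\<^esub> N) = p ^ k" using assms by (auto simp: pro_p_group_def)
  then have "card (rcosets\<^bsub>G\<^esub> N) > 0" using prime_gt_0_nat[OF assms(2)] by simp
  then show ?thesis by (rule card_ge_0_finite)
qed

lemma (in group) pow_index_mem:
  assumes N: "N \<lhd> G" and fin: "finite (rcosets N)" and x: "x \<in> carrier G"
  shows "x [^] card (rcosets N) \<in> N"
proof -
  interpret q: group_hom G "G Mod N" "\<lambda>x. N #> x"
    using normal.r_coset_hom_Mod[OF N] normal.factorgroup_is_group[OF N]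
    by (intro group_hom.intro group_hom_axioms.intro group_axioms)
  have "(N #> x) [^]\<^bsub>G Mod N\<^esub> card (rcosets N) = \<one>\<^bsub>G Mod N\<^esub>"
    using q.H.pow_order_eq_1[OF q.hom_closed[OF x]] by (simp add: Coset.order_def FactGroup_def)
  then have "N #> (x [^] card (rcosets N)) = N"
    using x by (simp add: q.hom_nat_pow)
  then show ?thesis by (rule coset_join1) (use x normal_imp_subgroup[OF N] in auto)
qed

text \<open>The expansion along words has no inverse letters, so positive words are required. They
  suffice modulo \<open>K\<close>: the power of any element to the finite index of \<open>K\<close>
  lies in \<open>K\<close>, which supplies inverses. Hence words over \<open>Y\<close> times
  \<open>K\<close> form a subgroup; it is closed because it contains the open \<open>K\<close>, and
  it contains the topological generators \<open>X\<close>.\<close>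

lemma (in compact_group) list_prod_dense:
  assumes K: "K \<lhd> G" "openin T K" "finite (rcosets K)"
    and X: "closed_subgroup_generated G T X = carrier G" "X \<subseteq> Y \<union> K" "Y \<subseteq> carrier G"
    and s: "s \<in> carrier G"
  obtains xs k where "set xs \<subseteq> Y" "k \<in> K" "s = list_prod xs \<otimes> k"
proof -
  define M where "M = {list_prod xs \<otimes> k | xs k. set xs \<subseteq> Y \<and> k \<in> K}"
  have K': "subgroup K G" using K(1) by (rule normal_imp_subgroup)
  note Kc [simp] = subgroup.mem_carrier[OF K']
  have lc [simp]: "list_prod xs \<in> carrier G" if "set xs \<subseteq> Y" for xs
    using that X(3) by (intro list_prod_closed) auto
  have M_I: "list_prod xs \<otimes> k \<in> M" if "set xs \<subseteq> Y" "k \<in> K" for xs k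
    using that by (auto simp: M_def)
  have K_M: "K \<subseteq> M"
  proof
    fix k assume "k \<in> K" then show "k \<in> M" using M_I[of "[]" k] by simp
  qed
  have M_mult: "x \<otimes> y \<in> M" if "x \<in> M" "y \<in> M" for x y
  proof -
    obtain xs k ys l where *: "set xs \<subseteq> Y" "k \<in> K" "x = list_prod xs \<otimes> k" "set ys \<subseteq> Y" "l \<in> K" "y = list_prod ys \<otimes> l"
      using \<open>x \<in> M\<close> \<open>y \<in> M\<close> unfolding M_def by blast
    let ?k = "inv (list_prod ys) \<otimes> k \<otimes> inv (inv (list_prod ys)) \<otimes> l"
    have "inv (list_prod ys) \<otimes> k \<otimes> inv (inv (list_prod ys)) \<in> K"
      using K(1) *(2) inv_closed[OF lc[OF *(4)]] unfolding normal_inv_iff by blast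
    then have "?k \<in> K" by (rule subgroup.m_closed[OF K' _ *(5)])
    moreover have "x \<otimes> y = list_prod (xs @ ys) \<otimes> ?k"
      using * X(3) by (subst list_prod_append) (auto simp: m_assoc mult_inv_cancel)
    ultimately show ?thesis using M_I[of "xs @ ys" ?k] * by simp
  qed
  have M_car: "M \<subseteq> carrier G" by (auto simp: M_def)
  have M_pow: "x [^] (i::nat) \<in> M" if "x \<in> M" for x i
  proof (induction i)
    case 0
    show ?case using K_M subgroup.one_closed[OF K'] by auto
  next
    case (Suc i)
    then show ?case using M_mult that by simp
  qed
  have "subgroup M G"
  proof (rule subgroupI[OF M_car])
    show "M \<noteq> {}" using K_M subgroup.one_closed[OF K'] by auto
    fix x assume x: "x \<in> M"
    then have xc: "x \<in> carrier G" using M_car by auto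
    define m where "m = card (rcosets K)"
    have "m > 0" unfolding m_def using K(3) xc by (auto simp: card_gt_0_iff RCOSETS_def)
    then obtain m' where m': "m = Suc m'" by (cases m) auto
    have "x [^] m \<in> K" unfolding m_def by (rule pow_index_mem[OF K(1,3) xc])
    then have "inv (x [^] m) \<in> M" using K_M subgroup.m_inv_closed[OF K'] by auto
    then have "x [^] m' \<otimes> inv (x [^] m) \<in> M" by (intro M_mult M_pow x)
    also have "x [^] m' \<otimes> inv (x [^] m) = inv x"
    proof -
      have "x [^] m = x \<otimes> x [^] m'" unfolding m' by (rule nat_pow_Suc2[OF xc])
      then show ?thesis using xc by (simp add: inv_mult_group mult_inv_cancel)
    qed
    finally show "inv x \<in> M" .
  qed (rule M_mult)
  moreover have "closedin T M"
    by (rule open_subgroup_closedin[OF \<open>subgroup M G\<close> K(2) subgroup.one_closed[OF K'] K_M])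
  moreover have "X \<subseteq> M"
  proof
    fix x assume "x \<in> X"
    then consider "x \<in> Y" | "x \<in> K" using X(2) by auto
    then show "x \<in> M"
    proof cases
      case 1
      then show ?thesis using M_I[of "[x]" \<one>] subgroup.one_closed[OF K'] X(3) by auto
    qed (use K_M in auto)
  qed
  ultimately have "carrier G \<subseteq> M" using generated_minimal X(1) by blast
  then show ?thesis using s that unfolding M_def by blast
qed

lemma count_list_subseqs_Nil: "count_list (subseqs xs) [] = 1"
  by (induction xs) (auto simp: Let_def count_list_map_Cons)

lemma word_mat_eq_one: "x \<notin> set w \<Longrightarrow> word_mat n w x = 1\<^sub>m n"
  by (rule eq_matI) (auto simp: word_mat_def)

lemma sum_list_eq_sum_count:
  fixes f :: "'a \<Rightarrow> 'b::comm_semiring_1"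
  shows "sum_list (map f xs) = (\<Sum>x\<in>set xs. of_nat (count_list xs x) * f x)"
proof (induction xs)
  case (Cons y xs)
  have "(\<Sum>x\<in>set (y # xs). of_nat (count_list (y # xs) x) * f x)
      = (\<Sum>x\<in>set (y # xs). of_nat (count_list xs x) * f x + (if x = y then f y else 0))"
    by (intro sum.cong) (auto simp: algebra_simps)
  also have "\<dots> = (\<Sum>x\<in>set (y # xs). of_nat (count_list xs x) * f x) + f y"
    by (simp add: sum.distrib)
  also have "(\<Sum>x\<in>set (y # xs). of_nat (count_list xs x) * f x) = (\<Sum>x\<in>set xs. of_nat (count_list xs x) * f x)"
    by (intro sum.mono_neutral_right) (auto simp: count_list_0_iff)
  finally show ?case using Cons by (simp add: add.commute)
qed simp

text \<open>Generators that do not occur in \<open>w\<close> go to the identity matrix, so the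
  assignment converges to one even for infinite \<open>X\<close>. The lift into the unitriangular
  group is then regarded as a map into the general linear group.\<close>

lemma free_word_representation:
  assumes p: "p = CARD('p::prime_card)" and free: "free_pro_p_group_on p X S T"
  obtains \<rho> where "\<rho> \<in> continuous_hom S T (GL n :: 'p mod_ring mat monoid) (discrete_topology (carrier (GL n)))"
    "\<And>x. x \<in> X \<Longrightarrow> \<rho> x = word_mat n w x"
proof -
  let ?GL = "GL n :: 'p mod_ring mat monoid"
  let ?Q = "?GL\<lparr>carrier := unitri n\<rparr>"
  interpret GL: group ?GL by (rule GL_group)
  have "prime p" using p prime_card by simp
  moreover have "group ?Q" by (rule GL.subgroup_imp_group[OF subgroup_unitri])
  moreover have "card (carrier ?Q) = p ^ card (strict_pairs n)"
    using card_unitri[of n, where 'f = "'p mod_ring"] p by simp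
  moreover have "word_mat n w \<in> X \<rightarrow> carrier ?Q" using word_mat_unitri by auto
  moreover have "finite {x \<in> X. word_mat n w x \<noteq> \<one>\<^bsub>?Q\<^esub>}"
    by (rule finite_subset[of _ "set w"]) (auto simp: GL_simps intro: ccontr word_mat_eq_one)
  moreover have "finite (carrier ?Q)" using finite_unitri by simp
  ultimately obtain f where f: "f \<in> continuous_hom S T ?Q (discrete_topology (carrier ?Q))"
      "\<And>x. x \<in> X \<Longrightarrow> f x = word_mat n w x"
    using free_pro_p_group_on_lift[OF free, of ?Q "card (strict_pairs n)" "word_mat n w"] by blast
  have "unitri n \<subseteq> carrier ?GL" by (rule subgroup.subset[OF subgroup_unitri])
  then have "f \<in> hom S ?GL" using f(1) by (auto simp: continuous_hom_def hom_def Pi_def)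
  moreover have "continuous_map T (discrete_topology (carrier ?GL)) f"
  proof -
    have "continuous_map (discrete_topology (unitri n)) (discrete_topology (carrier ?GL)) id"
      using \<open>unitri n \<subseteq> carrier ?GL\<close> by auto
    then show ?thesis
      using continuous_map_compose[of T "discrete_topology (unitri n)" f _ id] f(1) by (simp add: continuous_hom_def)
  qed
  ultimately show ?thesis using f(2) that by (auto simp: continuous_hom_def)
qed

lemma hom_list_prod:
  assumes "group G" "\<rho> \<in> hom G (GL n :: 'f::field mat monoid)" "set xs \<subseteq> carrier G"
    "\<And>x. x \<in> set xs \<Longrightarrow> \<rho> x = word_mat n w x"
  shows "\<rho> (group.list_prod G xs) = word_mats n w xs"
proof -
  interpret group_hom G "GL n :: 'f mat monoid" \<rho>
    using assms GL_group by (intro group_hom.intro group_hom_axioms.intro) auto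
  show ?thesis using assms(3,4)
    by (induction xs) (auto simp: GL_simps(2,3) G.list_prod_closed hom_one[unfolded GL_simps(3)] hom_mult[unfolded GL_simps(2)])
qed

lemma kernel_continuous_hom:
  assumes "compact_group G T" "group H" "\<rho> \<in> continuous_hom G T H (discrete_topology (carrier H))"
  shows "kernel G H \<rho> \<lhd> G" "openin T (kernel G H \<rho>)"
proof -
  interpret compact_group G T by fact
  interpret group_hom G H \<rho>
    using assms by (intro group_hom.intro group_hom_axioms.intro group_axioms) (auto simp: continuous_hom_def)
  show "kernel G H \<rho> \<lhd> G" by (rule normal_kernel)
  have "openin (discrete_topology (carrier H)) {\<one>\<^bsub>H\<^esub>}" by simp
  moreover have "continuous_map T (discrete_topology (carrier H)) \<rho>" using assms by (simp add: continuous_hom_def)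
  ultimately have "openin T {x \<in> topspace T. \<rho> x \<in> {\<one>\<^bsub>H\<^esub>}}" by (rule openin_continuous_map_preimage[rotated])
  then show "openin T (kernel G H \<rho>)" by (simp add: kernel_def)
qed

lemma normal_INT:
  assumes "group G" "finite W" "N \<lhd> G" "\<And>w. w \<in> W \<Longrightarrow> K w \<lhd> G"
  shows "N \<inter> (\<Inter>w\<in>W. K w) \<lhd> G"
proof -
  interpret group G by fact
  have "subgroup (\<Inter>(insert N (K ` W))) G"
    using assms by (intro subgroups_Inter) (auto intro: normal_imp_subgroup)
  then show ?thesis using assms(3,4) by (auto simp: normal_inv_iff)
qed

lemma openin_INT_finite:
  assumes "finite W" "openin T N" "\<And>w. w \<in> W \<Longrightarrow> openin T (K w)"
  shows "openin T (N \<inter> (\<Inter>w\<in>W. K w))"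
proof -
  have "openin T (\<Inter>(insert N (K ` W)))" using assms by (intro openin_Inter) auto
  then show ?thesis by simp
qed

lemma representation_separates:
  fixes S :: "('a, 'm) monoid_scheme" and T :: "'a topology"
  assumes p: "p = CARD('p::prime_card)" and free: "free_pro_p_group_on p X S T" and "n \<ge> 1"
    and s: "s \<in> carrier S" "s \<notin> zassenhaus p S T n"
  shows "\<exists>\<rho> \<in> continuous_hom S T (GL n :: 'p mod_ring mat monoid) (discrete_topology (carrier (GL n))).
    \<rho> s \<noteq> \<one>\<^bsub>GL n\<^esub>"
proof (rule ccontr)
  let ?GL = "GL n :: 'p mod_ring mat monoid"
  let ?Hom = "continuous_hom S T ?GL (discrete_topology (carrier ?GL))"
  assume "\<not> ?thesis"
  then have trivial: "\<rho> s = \<one>\<^bsub>?GL\<^esub>" if "\<rho> \<in> ?Hom" for \<rho> using that by blast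
  have prime: "prime p" using p prime_card by simp
  have pro_p: "pro_p_group p S T" and X: "X \<subseteq> carrier S" "converges_to_one S T X (\<lambda>x. x)"
      "closed_subgroup_generated S T X = carrier S"
    using free by (auto simp: free_pro_p_group_on_def)
  have profinite: "profinite_group S T" using pro_p by (simp add: pro_p_group_def)
  interpret S: compact_group S T by (rule profinite_imp_compact_group[OF profinite])
  note Z = S.closed_normalD[OF S.zassenhaus_closed_normal[OF prime_ge_2_nat[OF prime]]]
  have td: "totally_disconnected_space T" using profinite by (simp add: profinite_group_def)
  \<comment> \<open>The coset of \<open>s\<close> modulo \<open>N\<close> avoids the closed
    \<open>n\<close>-th term, so \<open>s\<close> stays outside that term times \<open>N\<close>.
    The separating function is built for this coarser series, whose terms have finite index.\<close>
  obtain N where N: "N \<lhd> S" "openin T N" "\<And>x. x \<in> N \<Longrightarrow> s \<otimes>\<^bsub>S\<^esub> x \<notin> zassenhaus p S T n"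
    using S.open_normal_separation[OF td Z(3) s] by blast
  note N' = normal_imp_subgroup[OF N(1)]
  define P where "P i = zassenhaus p S T i <#>\<^bsub>S\<^esub> N" for i
  interpret series: restricted_series S P p
    unfolding P_def by (rule S.restricted_series_zassenhaus[OF prime N(1)])
  have N_P: "N \<subseteq> P n" unfolding P_def
    by (rule S.subset_set_mult_right[OF subgroup.subset[OF N'] Z(5)])
  have "s \<notin> P n"
  proof
    assume "s \<in> P n"
    then obtain a h where *: "s = a \<otimes>\<^bsub>S\<^esub> h" "a \<in> zassenhaus p S T n" "h \<in> N" by (auto simp: P_def set_mult_def)
    have "a \<in> carrier S" "h \<in> carrier S" using * Z(4) subgroup.mem_carrier[OF N'] by auto
    then have "s \<otimes>\<^bsub>S\<^esub> inv\<^bsub>S\<^esub> h = a" using * by (simp add: S.m_assoc)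
    then show False using N(3)[OF subgroup.m_inv_closed[OF N' *(3)]] * by simp
  qed
  have char: "of_nat a = (0::'p mod_ring) \<longleftrightarrow> p dvd a" for a
    by (simp add: of_nat_eq_0_iff_char_dvd p)
  have "finite (rcosets\<^bsub>S\<^esub> (P n))"
    by (rule S.finite_rcosets_mono[OF pro_p_finite_index[OF pro_p prime N(1,2)] N' series.subgroup_series N_P])
  from series.polyn_separates[OF char this _ S.subgroup_self subgroup.subset[OF series.subgroup_series] s(1) \<open>s \<notin> P n\<close>]
  obtain f :: "'a \<Rightarrow> 'p mod_ring" where f: "series.polyn (carrier S) n f" "f s \<noteq> f \<one>\<^bsub>S\<^esub>"
    using \<open>n \<ge> 1\<close> by auto
  \<comment> \<open>Elements of \<open>N\<close> lie in \<open>P n\<close>, and a difference of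
    weight \<open>n\<close> lowers the bound \<open>n\<close> to 0.\<close>
  have f_N: "f (x \<otimes>\<^bsub>S\<^esub> y) = f x" if "x \<in> carrier S" "y \<in> N" for x y
  proof -
    have "y \<in> carrier S" "y \<in> P (Suc (n - 1))" using that N_P subgroup.mem_carrier[OF N'] \<open>n \<ge> 1\<close> by auto
    from series.polynD[OF f(1) S.subgroup_self this] show ?thesis using that \<open>n \<ge> 1\<close> by simp
  qed
  \<comment> \<open>Finite, because the generators converge to one and \<open>N\<close> is an open
    neighbourhood of the identity.\<close>
  define Y where "Y = {x \<in> X. x \<notin> N}"
  have "finite Y"
    using X(2) N(2) subgroup.one_closed[OF N'] by (auto simp: Y_def converges_to_one_def)
  define W where "W = {w. set w \<subseteq> Y \<and> length w \<le> n - 1}"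
  have "finite W" unfolding W_def by (rule finite_lists_length_le[OF \<open>finite Y\<close>])
  have "\<forall>w. \<exists>\<rho>. \<rho> \<in> ?Hom \<and> (\<forall>x\<in>X. \<rho> x = word_mat n w x)"
  proof
    fix w show "\<exists>\<rho>. \<rho> \<in> ?Hom \<and> (\<forall>x\<in>X. \<rho> x = word_mat n w x)"
      by (rule free_word_representation[OF p free, of n w]) blast
  qed
  from choice[OF this]
  obtain \<rho> where \<rho>: "\<And>w. \<rho> w \<in> ?Hom" "\<And>w x. x \<in> X \<Longrightarrow> \<rho> w x = word_mat n w x" by blast
  define K where "K = N \<inter> (\<Inter>w\<in>W. kernel S ?GL (\<rho> w))"
  note ker = kernel_continuous_hom[OF S.compact_group_axioms GL_group \<rho>(1)]
  have K: "K \<lhd> S" "openin T K"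
    unfolding K_def by (rule normal_INT openin_INT_finite S.group_axioms \<open>finite W\<close> N ker)+
  \<comment> \<open>Generators outside \<open>Y\<close> lie in \<open>N\<close> and occur in no word
    of \<open>W\<close>, so every chosen representation is trivial on them.\<close>
  have "X \<subseteq> Y \<union> K"
  proof
    fix x assume x: "x \<in> X"
    have "x \<in> K" if "x \<notin> Y"
    proof -
      have "\<rho> w x = \<one>\<^bsub>?GL\<^esub>" if "w \<in> W" for w
      proof -
        have "x \<notin> set w" using that \<open>x \<notin> Y\<close> by (auto simp: W_def)
        then show ?thesis using \<rho>(2)[OF x] by (simp add: word_mat_eq_one GL_simps)
      qed
      then show ?thesis using \<open>x \<notin> Y\<close> x X(1) by (auto simp: K_def Y_def kernel_def)
    qed
    then show "x \<in> Y \<union> K" by blast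
  qed
  moreover have Y: "Y \<subseteq> carrier S" using X(1) by (auto simp: Y_def)
  ultimately obtain xs k where xs: "set xs \<subseteq> Y" "k \<in> K" "s = S.list_prod xs \<otimes>\<^bsub>S\<^esub> k"
    using S.list_prod_dense[OF K pro_p_finite_index[OF pro_p prime K] X(3) _ _ s(1)] by blast
  have xs_car: "set xs \<subseteq> carrier S" and xs_X: "set xs \<subseteq> X" using xs(1) Y by (auto simp: Y_def)
  note prod_car = S.list_prod_closed[OF xs_car]
  have "f s = f (S.list_prod xs)" using f_N[OF prod_car] xs by (simp add: K_def)
  also have "\<dots> = f (\<one>\<^bsub>S\<^esub> \<otimes>\<^bsub>S\<^esub> S.list_prod xs)" using prod_car by simp
  also have "\<dots> = (\<Sum>u\<leftarrow>subseqs xs. S.word_diff u f \<one>\<^bsub>S\<^esub>)"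
    by (rule S.eval_list_prod[OF xs_car]) simp
  also have "\<dots> = (\<Sum>u\<in>set (subseqs xs). of_nat (count_list (subseqs xs) u) * S.word_diff u f \<one>\<^bsub>S\<^esub>)"
    by (rule sum_list_eq_sum_count)
  \<comment> \<open>The empty subsequence occurs exactly once. A nonempty one shorter than
    \<open>n\<close> has multiplicity zero in the field, since its representation is trivial at
    \<open>s\<close>. For length at least \<open>n\<close> the difference vanishes.\<close>
  also have "\<dots> = (\<Sum>u\<in>set (subseqs xs). if u = [] then f \<one>\<^bsub>S\<^esub> else 0)"
  proof (intro sum.cong refl)
    fix u assume u: "u \<in> set (subseqs xs)"
    then have u_Y: "set u \<subseteq> Y" using subseqs_powset[of xs] xs(1) by auto
    show "of_nat (count_list (subseqs xs) u) * S.word_diff u f \<one>\<^bsub>S\<^esub> = (if u = [] then f \<one>\<^bsub>S\<^esub> else 0)"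
    proof (cases "u = []")
      case True
      then show ?thesis by (simp add: count_list_subseqs_Nil)
    next
      case False
      show ?thesis
      proof (cases "length u < n")
        case True
        then have "u \<in> W" using u_Y by (auto simp: W_def)
        interpret \<rho>: group_hom S ?GL "\<rho> u"
          using \<rho>(1)[of u] GL_group by (intro group_hom.intro group_hom_axioms.intro S.group_axioms) (auto simp: continuous_hom_def)
        have k: "k \<in> carrier S" "\<rho> u k = \<one>\<^bsub>?GL\<^esub>" using xs(2) \<open>u \<in> W\<close> by (auto simp: K_def kernel_def)
        have "\<rho> u (S.list_prod xs) = \<rho> u s"
          using xs(3) k prod_car by simp
        also have "\<dots> = 1\<^sub>m n" using trivial[OF \<rho>(1)] by (simp add: GL_simps)
        also have "\<rho> u (S.list_prod xs) = word_mats n u xs"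
          using xs_X \<rho>(2) by (intro hom_list_prod S.group_axioms \<rho>.homh xs_car) auto
        \<comment> \<open>For nonempty \<open>u\<close> with \<open>length u < n\<close> this is an
          off-diagonal entry of the identity matrix.\<close>
        finally have "(word_mats n u xs :: 'p mod_ring mat) $$ (0, length u) = 0"
          using True False by simp
        then have "of_nat (count_list (subseqs xs) u) = (0 :: 'p mod_ring)"
          using word_mats_index[OF True, of 0 xs, where 'f = "'p mod_ring"] by simp
        then show ?thesis using False by simp
      next
        case False
        then have "S.word_diff u f \<one>\<^bsub>S\<^esub> = 0"
          using u_Y Y by (intro series.word_diff_eq_0[OF f(1)]) auto
        then show ?thesis using \<open>u \<noteq> []\<close> by simp
      qed
    qed
  qed
  also have "\<dots> = f \<one>\<^bsub>S\<^esub>"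
  proof -
    have "[] \<in> set (subseqs xs)" using count_list_subseqs_Nil[of xs] count_list_0_iff[of "subseqs xs" "[]"] by auto
    then show ?thesis by simp
  qed
  finally show False using f(2) by simp
qed

section \<open>Unipotence of \<open>p\<close>-groups in characteristic \<open>p\<close>\<close>

text \<open>Orbit sizes divide the order of the group, so an orbit is a fixed point or has size
  divisible by \<open>p\<close>.\<close>

lemma card_fixed_points_mod:
  fixes G (structure)
  assumes "group G" and order: "Coset.order G = p ^ k" and p: "prime p" and "finite X"
    and closed: "\<And>g x. \<lbrakk>g \<in> carrier G; x \<in> X\<rbrakk> \<Longrightarrow> a g x \<in> X"
    and one: "\<And>x. x \<in> X \<Longrightarrow> a \<one> x = x"
    and mult: "\<And>g h x. \<lbrakk>g \<in> carrier G; h \<in> carrier G; x \<in> X\<rbrakk> \<Longrightarrow> a (g \<otimes> h) x = a g (a h x)"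
  shows "card {x \<in> X. \<forall>g\<in>carrier G. a g x = x} mod p = card X mod p"
proof -
  interpret group G by fact
  \<comment> \<open>Members of \<open>BijGroup X\<close> are extensional, hence the
    restriction.\<close>
  define \<phi> where "\<phi> g = restrict (a g) X" for g
  have Bij: "\<phi> g \<in> Bij X" if g: "g \<in> carrier G" for g
  proof -
    have "bij_betw (a g) X X"
      by (rule bij_betw_byWitness[where f' = "a (inv g)"])
        (use g closed in \<open>auto simp: one simp flip: mult\<close>)
    then have "bij_betw (\<phi> g) X X" by (simp add: \<phi>_def bij_betw_restrict_eq)
    then show ?thesis by (simp add: Bij_def \<phi>_def)
  qed
  interpret A: group_action G X \<phi>
  proof (intro group_action.intro group_hom.intro group_hom_axioms.intro homI)
    show "group G" by fact
    show "group (BijGroup X)" by (rule group_BijGroup)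
    show "\<phi> g \<in> carrier (BijGroup X)" if "g \<in> carrier G" for g
      using Bij[OF that] by (simp add: BijGroup_def)
    show "\<phi> (g \<otimes> h) = \<phi> g \<otimes>\<^bsub>BijGroup X\<^esub> \<phi> h" if "g \<in> carrier G" "h \<in> carrier G" for g h
    proof -
      have "\<phi> (g \<otimes> h) = compose X (\<phi> g) (\<phi> h)"
        using that closed mult by (auto simp: \<phi>_def compose_def fun_eq_iff)
      then show ?thesis using Bij that by (simp add: BijGroup_def)
    qed
  qed
  let ?Fix = "{x \<in> X. \<forall>g\<in>carrier G. a g x = x}"
  let ?O = "orbits G X \<phi>"
  have O_sub: "C \<subseteq> X" if "C \<in> ?O" for C using A.orbits_coverture that by auto
  have fin_O: "finite ?O"
    using finite_subset[of ?O "Pow X"] O_sub \<open>finite X\<close> by auto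
  have fix_iff: "orbit G \<phi> x = {x} \<longleftrightarrow> x \<in> ?Fix" if "x \<in> X" for x
    using that A.orbit_refl[OF that] by (auto simp: orbit_def \<phi>_def)
  have orbit_card: "card C = 1 \<or> p dvd card C" if C: "C \<in> ?O" for C
  proof -
    obtain x where x: "x \<in> X" "C = orbit G \<phi> x" using C by (auto simp: orbits_def)
    then have "card C dvd p ^ k" using A.orbit_stabilizer_theorem[OF x(1)] order by (metis dvd_triv_left)
    then obtain i where "card C = p ^ i" using divides_primepow_nat[OF p] by auto
    then show ?thesis by (cases i) auto
  qed
  have "card X = (\<Sum>C\<in>?O. card C)"
    using A.disjoint_sum[OF \<open>finite X\<close>, of "\<lambda>_. 1::nat"] by simp
  also have "\<dots> = (\<Sum>C\<in>{C\<in>?O. card C = 1}. card C) + (\<Sum>C\<in>{C\<in>?O. card C \<noteq> 1}. card C)"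
    using fin_O by (subst sum.union_disjoint[symmetric]) (auto intro!: sum.cong)
  also have "(\<Sum>C\<in>{C\<in>?O. card C = 1}. card C) = card {C\<in>?O. card C = 1}" by simp
  also have "card {C\<in>?O. card C = 1} = card ?Fix"
  proof (rule bij_betw_same_card[symmetric])
    have "(\<lambda>x. {x}) ` ?Fix = {C\<in>?O. card C = 1}"
    proof (intro subset_antisym subsetI)
      fix C assume "C \<in> (\<lambda>x. {x}) ` ?Fix"
      then obtain x where x: "x \<in> ?Fix" "C = {x}" by blast
      have "x \<in> X" using x(1) by simp
      then have "C = orbit G \<phi> x" using fix_iff x by blast
      with \<open>x \<in> X\<close> have "C \<in> ?O" unfolding orbits_def by blast
      then show "C \<in> {C\<in>?O. card C = 1}" using x(2) by simp
    next
      fix C assume "C \<in> {C\<in>?O. card C = 1}"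
      then obtain x y where x: "x \<in> X" "C = orbit G \<phi> x" "C = {y}" by (auto simp: orbits_def card_1_singleton_iff)
      then have "x = y" using A.orbit_refl[OF x(1)] by auto
      then show "C \<in> (\<lambda>x. {x}) ` ?Fix" using x fix_iff[OF x(1)] by blast
    qed
    then show "bij_betw (\<lambda>x. {x}) ?Fix {C\<in>?O. card C = 1}" by (simp add: bij_betw_def)
  qed
  finally have "card X = card ?Fix + (\<Sum>C\<in>{C\<in>?O. card C \<noteq> 1}. card C)" .
  moreover have "p dvd (\<Sum>C\<in>{C\<in>?O. card C \<noteq> 1}. card C)"
    using orbit_card by (intro dvd_sum) auto
  ultimately show ?thesis by (auto elim!: dvdE)
qed

text \<open>The ring type provides \<open>of_nat k * v\<close> as the \<open>k\<close>-fold multiple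
  of a vector; the instance is functions on \<open>nat\<close> supported below \<open>n\<close>,
  with pointwise operations. The dimension enters through the order \<open>p ^ n\<close> of
  \<open>V\<close>, and the action is taken as additive.\<close>

locale p_group_module = group G for G (structure) +
  fixes V :: "'v::comm_ring_1 set" and \<alpha> :: "'a \<Rightarrow> 'v \<Rightarrow> 'v" and p n :: nat
  assumes p: "prime p" and p_order: "\<exists>k. Coset.order G = p ^ k"
    and zero_V: "0 \<in> V" and diff_V: "\<lbrakk>u \<in> V; v \<in> V\<rbrakk> \<Longrightarrow> u - v \<in> V" and card_V: "card V = p ^ n"
    and char_p: "of_nat p = (0::'v)"
    and act_V: "\<lbrakk>g \<in> carrier G; v \<in> V\<rbrakk> \<Longrightarrow> \<alpha> g v \<in> V"
    and act_add: "\<lbrakk>g \<in> carrier G; u \<in> V; v \<in> V\<rbrakk> \<Longrightarrow> \<alpha> g (u + v) = \<alpha> g u + \<alpha> g v"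
    and act_one: "v \<in> V \<Longrightarrow> \<alpha> \<one> v = v"
    and act_mult: "\<lbrakk>g \<in> carrier G; h \<in> carrier G; v \<in> V\<rbrakk> \<Longrightarrow> \<alpha> (g \<otimes> h) v = \<alpha> g (\<alpha> h v)"
begin

lemma finite_V: "finite V"
  using card_V prime_gt_0_nat[OF p] by (intro card_ge_0_finite) simp

definition additive_subgroup :: "'v set \<Rightarrow> bool" where
  "additive_subgroup A \<longleftrightarrow> A \<subseteq> V \<and> 0 \<in> A \<and> (\<forall>u\<in>A. \<forall>v\<in>A. u - v \<in> A)"

lemma additive_subgroupD:
  assumes "additive_subgroup A"
  shows "v \<in> A \<Longrightarrow> v \<in> V" "0 \<in> A" "\<lbrakk>u \<in> A; v \<in> A\<rbrakk> \<Longrightarrow> u - v \<in> A" "v \<in> A \<Longrightarrow> - v \<in> A"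
    "\<lbrakk>u \<in> A; v \<in> A\<rbrakk> \<Longrightarrow> u + v \<in> A"
proof -
  show d: "u - v \<in> A" if "u \<in> A" "v \<in> A" for u v using assms that by (auto simp: additive_subgroup_def)
  show z: "0 \<in> A" and "v \<in> A \<Longrightarrow> v \<in> V" for v using assms by (auto simp: additive_subgroup_def)
  show m: "- v \<in> A" if "v \<in> A" for v using d[OF z that] by simp
  show "u + v \<in> A" if "u \<in> A" "v \<in> A" for u v using d[OF that(1) m[OF that(2)]] by simp
qed

lemma additive_subgroup_V: "additive_subgroup V"
  using zero_V diff_V by (simp add: additive_subgroup_def)

lemmas V_simps = additive_subgroupD(2-5)[OF additive_subgroup_V]

lemma act_diff: "\<lbrakk>g \<in> carrier G; u \<in> V; v \<in> V\<rbrakk> \<Longrightarrow> \<alpha> g (u - v) = \<alpha> g u - \<alpha> g v"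
  using act_add[of g "u - v" v] diff_V[of u v] by (simp add: algebra_simps)

definition V_group :: "'v monoid" where
  "V_group = \<lparr>carrier = V, mult = (+), one = 0\<rparr>"

lemma V_group: "group V_group"
proof (rule groupI)
  fix x assume "x \<in> carrier V_group"
  then show "\<exists>y\<in>carrier V_group. y \<otimes>\<^bsub>V_group\<^esub> x = \<one>\<^bsub>V_group\<^esub>"
    using V_simps by (intro bexI[of _ "- x"]) (auto simp: V_group_def)
qed (use V_simps in \<open>auto simp: V_group_def algebra_simps\<close>)

lemma V_group_subgroup:
  assumes "additive_subgroup A" shows "subgroup A V_group"
proof -
  interpret V: group V_group by (rule V_group)
  note A = additive_subgroupD[OF assms]
  have "inv\<^bsub>V_group\<^esub> x = - x" if "x \<in> A" for x
    using A V_simps that by (intro V.inv_equality) (auto simp: V_group_def)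
  then show ?thesis using A by (intro V.subgroupI) (auto simp: V_group_def)
qed

lemma additive_subgroup_card:
  assumes "additive_subgroup A"
  shows "card (rcosets\<^bsub>V_group\<^esub> A) * card A = p ^ n"
  using group.lagrange[OF V_group V_group_subgroup[OF assms]] card_V
  by (simp add: Coset.order_def V_group_def)

text \<open>The group acts on the cosets of \<open>A\<close>, whose number is a power of
  \<open>p\<close> greater than 1. So the number of fixed cosets is divisible by \<open>p\<close>;
  \<open>A\<close> is one of them, hence there is another, and its representative is the vector
  sought.\<close>

lemma fixed_vector_mod:
  assumes A: "additive_subgroup A" "A \<noteq> V" and stable: "\<And>g v. \<lbrakk>g \<in> carrier G; v \<in> A\<rbrakk> \<Longrightarrow> \<alpha> g v \<in> A"
  shows "\<exists>v \<in> V - A. \<forall>g\<in>carrier G. \<alpha> g v - v \<in> A"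
proof -
  interpret V: group V_group by (rule V_group)
  note AD = additive_subgroupD[OF A(1)]
  define X where "X = (\<lambda>v. (\<lambda>h. h + v) ` A) ` V"
  have X_eq: "X = rcosets\<^bsub>V_group\<^esub> A"
    by (auto simp: X_def RCOSETS_def r_coset_def V_group_def)
  have img: "\<alpha> g ` ((\<lambda>h. h + v) ` A) = (\<lambda>h. h + \<alpha> g v) ` A" if g: "g \<in> carrier G" and v: "v \<in> V" for g v
  proof -
    have "\<alpha> g ` A = A"
    proof (rule subset_antisym)
      show "A \<subseteq> \<alpha> g ` A"
      proof
        fix u assume "u \<in> A"
        then have "u = \<alpha> g (\<alpha> (inv g) u)"
          using g AD act_one by (simp flip: act_mult)
        then show "u \<in> \<alpha> g ` A" using stable[OF inv_closed[OF g] \<open>u \<in> A\<close>] by blast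
      qed
    qed (use stable g in auto)
    then have "(\<lambda>h. h + \<alpha> g v) ` \<alpha> g ` A = (\<lambda>h. h + \<alpha> g v) ` A" by simp
    then show ?thesis using g v AD by (auto simp: image_image act_add cong: image_cong)
  qed
  have A_X: "A \<in> X"
    using imageI[OF V_simps(1), of "\<lambda>v. (\<lambda>h. h + v) ` A"] by (simp add: X_def)
  have fin_X: "finite X" unfolding X_def using finite_V by simp
  have X_V: "C \<subseteq> V" if "C \<in> X" for C using that AD V_simps by (auto simp: X_def)
  obtain k where k: "Coset.order G = p ^ k" using p_order by blast
  let ?Fix = "{C \<in> X. \<forall>g\<in>carrier G. \<alpha> g ` C = C}"
  have "card ?Fix mod p = card X mod p"
  proof (rule card_fixed_points_mod[OF group_axioms k p fin_X])
    show "\<alpha> g ` C \<in> X" if "g \<in> carrier G" "C \<in> X" for g C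
      using that img act_V by (auto simp: X_def)
    show "\<alpha> \<one> ` C = C" if "C \<in> X" for C
      using X_V[OF that] act_one by force
    show "\<alpha> (g \<otimes> h) ` C = \<alpha> g ` \<alpha> h ` C" if "g \<in> carrier G" "h \<in> carrier G" "C \<in> X" for g h C
      using X_V[OF that(3)] that(1,2) act_mult by (auto simp: image_image subset_iff cong: image_cong)
  qed
  moreover have "p dvd card X"
  proof -
    have prod: "card X * card A = p ^ n" unfolding X_eq by (rule additive_subgroup_card[OF A(1)])
    then have "card X dvd p ^ n" by (metis dvd_triv_left)
    then obtain i where i: "card X = p ^ i" using divides_primepow_nat[OF p] by auto
    have "A \<subset> V" using A AD by auto
    then have "card A < p ^ n" using psubset_card_mono[OF finite_V] card_V by simp
    then have "i \<noteq> 0" using prod i by (cases i) auto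
    then show ?thesis using i by simp
  qed
  ultimately have "p dvd card ?Fix" by (simp add: dvd_eq_mod_eq_0)
  moreover have A_Fix: "A \<in> ?Fix"
    using A_X img[OF _ V_simps(1)] act_diff[of _ 0 0] V_simps(1) by auto
  moreover have "finite ?Fix" using fin_X by simp
  ultimately have "p \<le> card ?Fix" by (intro dvd_imp_le) (auto simp: card_gt_0_iff)
  then have "1 < card ?Fix" using prime_gt_1_nat[OF p] by linarith
  then have "?Fix \<noteq> {A}" by (metis card_1_singleton_iff less_irrefl One_nat_def)
  then obtain C where C: "C \<in> ?Fix" "C \<noteq> A" using A_Fix by blast
  then obtain v where v: "v \<in> V" "C = (\<lambda>h. h + v) ` A" by (auto simp: X_def)
  have "v \<notin> A"
  proof
    assume "v \<in> A"
    then have "C = A" unfolding v(2)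
      using AD by (auto intro!: image_eqI[of _ _ "_ - v"])
    with C show False by simp
  qed
  moreover have "\<alpha> g v - v \<in> A" if g: "g \<in> carrier G" for g
  proof -
    have "v \<in> C" using v AD(2) by (auto intro!: image_eqI[of _ _ 0])
    then have "\<alpha> g v \<in> C" using C g by auto
    then show ?thesis using v by auto
  qed
  ultimately show ?thesis using v by blast
qed

text \<open>Each step is the preimage of the fixed vectors of \<open>V\<close> modulo the previous
  step, so the group acts trivially on successive quotients.\<close>

primrec flag :: "nat \<Rightarrow> 'v set" where
  "flag 0 = {0}"
| "flag (Suc k) = {v \<in> V. \<forall>g\<in>carrier G. \<alpha> g v - v \<in> flag k}"

lemma flag_additive: "additive_subgroup (flag k)"
proof (induction k)
  case 0
  then show ?case using V_simps by (simp add: additive_subgroup_def)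
next
  case (Suc k)
  note IH = additive_subgroupD[OF Suc]
  have "u - v \<in> flag (Suc k)" if "u \<in> flag (Suc k)" "v \<in> flag (Suc k)" for u v
  proof -
    have uv: "u \<in> V" "v \<in> V" using that by auto
    have "\<alpha> g (u - v) - (u - v) \<in> flag k" if g: "g \<in> carrier G" for g
    proof -
      have "(\<alpha> g u - u) - (\<alpha> g v - v) \<in> flag k"
        by (rule IH(3)) (use \<open>u \<in> flag (Suc k)\<close> \<open>v \<in> flag (Suc k)\<close> g in auto)
      then show ?thesis using g uv by (simp add: act_diff algebra_simps)
    qed
    then show ?thesis using uv diff_V by simp
  qed
  moreover have "0 \<in> flag (Suc k)"
    using V_simps(1) act_diff[of _ 0 0] IH(2) by auto
  ultimately show ?case by (auto simp: additive_subgroup_def)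
qed

lemmas flagD = additive_subgroupD[OF flag_additive]

lemma flag_Suc: "flag k \<subseteq> flag (Suc k)"
proof (induction k)
  case 0
  then show ?case using flagD(2)[of "Suc 0"] by simp
next
  case (Suc k)
  then show ?case by auto
qed

lemma flag_mono: "i \<le> j \<Longrightarrow> flag i \<subseteq> flag j"
  by (rule lift_Suc_mono_le[of flag]) (rule flag_Suc)

lemma flag_stable:
  assumes "g \<in> carrier G" "v \<in> flag k"
  shows "\<alpha> g v \<in> flag k"
proof (cases k)
  case 0
  then show ?thesis using assms act_diff[of g 0 0] V_simps(1) by auto
next
  case (Suc j)
  then have "\<alpha> g v - v \<in> flag k" using assms flag_Suc[of j] by auto
  from flagD(5)[OF this assms(2)] show ?thesis by simp
qed

text \<open>Until it reaches \<open>V\<close> the flag grows strictly, and its orders are powers of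
  \<open>p\<close>, so each step multiplies the order by at least \<open>p\<close>. As
  \<open>V\<close> has order \<open>p ^ n\<close>, the flag is complete after \<open>n\<close>
  steps.\<close>

lemma flag_card: "flag k = V \<or> p ^ k \<le> card (flag k)"
proof (induction k)
  case (Suc k)
  show ?case
  proof (cases "flag k = V")
    case True
    then show ?thesis using flag_Suc[of k] flagD(1)[of _ "Suc k"] by blast
  next
    case False
    obtain v where "v \<in> V - flag k" "\<forall>g\<in>carrier G. \<alpha> g v - v \<in> flag k"
      using fixed_vector_mod[OF flag_additive False flag_stable] by blast
    then have "flag k \<subset> flag (Suc k)" using flag_Suc[of k] by auto
    moreover have "finite (flag (Suc k))" by (rule finite_subset[OF _ finite_V]) auto
    ultimately have less: "card (flag k) < card (flag (Suc k))" by (rule psubset_card_mono[rotated])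
    have "card (flag (Suc k)) dvd p ^ n"
      using additive_subgroup_card[OF flag_additive, of "Suc k"] by (metis dvd_triv_right)
    then obtain i where i: "card (flag (Suc k)) = p ^ i" using divides_primepow_nat[OF p] by blast
    have "p ^ k < p ^ i" using less Suc False i by linarith
    then have "k < i" using prime_gt_1_nat[OF p] by (simp add: power_strict_increasing_iff)
    then have "p ^ Suc k \<le> p ^ i" using prime_gt_0_nat[OF p] by (intro power_increasing) auto
    then show ?thesis using i by simp
  qed
qed simp

lemma flag_n: "flag n = V"
proof -
  have "flag n \<subseteq> V" using flagD(1) by blast
  then show ?thesis using flag_card[of n] card_seteq[OF finite_V, of "flag n"] card_V by auto
qed

definition depth_subgroup :: "nat \<Rightarrow> 'a set" where
  "depth_subgroup i = {g \<in> carrier G. \<forall>k. \<forall>v\<in>flag (k + i). \<alpha> g v - v \<in> flag k}"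

lemma depthD: "\<lbrakk>g \<in> depth_subgroup i; v \<in> flag (k + i)\<rbrakk> \<Longrightarrow> \<alpha> g v - v \<in> flag k"
  by (simp add: depth_subgroup_def)

lemma depth_closed: "g \<in> depth_subgroup i \<Longrightarrow> g \<in> carrier G"
  by (simp add: depth_subgroup_def)

lemma depth_subgroup: "subgroup (depth_subgroup i) G"
proof (rule subgroupI)
  have "\<one> \<in> depth_subgroup i"
    using flagD(1,2) act_one by (auto simp: depth_subgroup_def)
  then show "depth_subgroup i \<noteq> {}" by blast
next
  fix g assume g: "g \<in> depth_subgroup i"
  note gc = depth_closed[OF g]
  show "inv g \<in> depth_subgroup i"
    unfolding depth_subgroup_def
  proof (intro CollectI conjI allI ballI)
    fix k v assume v: "v \<in> flag (k + i)"
    have u: "\<alpha> (inv g) v \<in> flag (k + i)" by (rule flag_stable) (use gc v in auto)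
    have "\<alpha> g (\<alpha> (inv g) v) = v" using gc flagD(1)[OF v] act_one by (simp flip: act_mult)
    then have "- (v - \<alpha> (inv g) v) \<in> flag k" using depthD[OF g u] flagD(4) by metis
    then show "\<alpha> (inv g) v - v \<in> flag k" by simp
  qed (use gc in simp)
  fix h assume h: "h \<in> depth_subgroup i"
  note hc = depth_closed[OF h]
  show "g \<otimes> h \<in> depth_subgroup i"
    unfolding depth_subgroup_def
  proof (intro CollectI conjI allI ballI)
    fix k v assume v: "v \<in> flag (k + i)"
    have "(\<alpha> g (\<alpha> h v) - \<alpha> h v) + (\<alpha> h v - v) \<in> flag k"
      by (intro flagD(5) depthD[OF g] depthD[OF h] flag_stable v hc)
    then show "\<alpha> (g \<otimes> h) v - v \<in> flag k" using gc hc flagD(1)[OF v] by (simp add: act_mult)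
  qed (use gc hc in simp)
qed (simp add: depth_subgroup_def)

lemma depth_1: "depth_subgroup (Suc 0) = carrier G"
  by (auto simp: depth_subgroup_def)

lemma depth_antimono: "i \<le> j \<Longrightarrow> depth_subgroup j \<subseteq> depth_subgroup i"
proof
  fix g assume "i \<le> j" and g: "g \<in> depth_subgroup j"
  then have "flag (k + i) \<subseteq> flag (k + j)" for k by (intro flag_mono) simp
  with g show "g \<in> depth_subgroup i" by (auto simp: depth_subgroup_def)
qed

text \<open>The operators \<open>g - 1\<close> and \<open>h - 1\<close> lower the flag by
  \<open>i\<close> and \<open>j\<close> steps, and their commutator is \<open>g h - h g\<close>.
  Applying the inverse of \<open>h g\<close>, which preserves the flag, turns this into the group
  commutator minus 1.\<close>

lemma depth_comm:
  assumes g: "g \<in> depth_subgroup i" and h: "h \<in> depth_subgroup j"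
  shows "inv g \<otimes> inv h \<otimes> g \<otimes> h \<in> depth_subgroup (i + j)"
  unfolding depth_subgroup_def
proof (intro CollectI conjI allI ballI)
  note c [simp] = depth_closed[OF g] depth_closed[OF h]
  show "inv g \<otimes> inv h \<otimes> g \<otimes> h \<in> carrier G" by simp
  fix k v assume v: "v \<in> flag (k + (i + j))"
  have vV: "v \<in> V" by (rule flagD(1)[OF v])
  note V = vV act_V[OF c(1) vV] act_V[OF c(2) vV]
  have "\<alpha> h v - v \<in> flag (k + i)" using depthD[OF h, of v "k + i"] v by (simp add: add.assoc)
  from depthD[OF g this] have 1: "\<alpha> g (\<alpha> h v - v) - (\<alpha> h v - v) \<in> flag k" .
  have "\<alpha> g v - v \<in> flag (k + j)" using depthD[OF g, of v "k + j"] v by (simp add: ac_simps)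
  from depthD[OF h this] have 2: "\<alpha> h (\<alpha> g v - v) - (\<alpha> g v - v) \<in> flag k" .
  have "\<alpha> (g \<otimes> h) v - \<alpha> (h \<otimes> g) v \<in> flag k"
    using flagD(3)[OF 1 2] V by (simp add: act_diff act_mult algebra_simps)
  then have "\<alpha> (inv (h \<otimes> g)) (\<alpha> (g \<otimes> h) v - \<alpha> (h \<otimes> g) v) \<in> flag k"
    by (intro flag_stable) auto
  also have "\<alpha> (inv (h \<otimes> g)) (\<alpha> (g \<otimes> h) v - \<alpha> (h \<otimes> g) v)
      = \<alpha> (inv (h \<otimes> g) \<otimes> (g \<otimes> h)) v - \<alpha> (inv (h \<otimes> g) \<otimes> (h \<otimes> g)) v"
    unfolding act_diff[OF inv_closed[OF m_closed[OF c(2,1)]] act_V[OF m_closed[OF c] vV] act_V[OF m_closed[OF c(2,1)] vV]]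
      act_mult[OF inv_closed[OF m_closed[OF c(2,1)]] m_closed[OF c] vV]
      act_mult[OF inv_closed[OF m_closed[OF c(2,1)]] m_closed[OF c(2,1)] vV] ..
  also have "inv (h \<otimes> g) \<otimes> (h \<otimes> g) = \<one>" by (rule l_inv) simp
  also have "inv (h \<otimes> g) \<otimes> (g \<otimes> h) = inv g \<otimes> inv h \<otimes> g \<otimes> h" by (simp add: inv_mult_group m_assoc)
  finally show "\<alpha> (inv g \<otimes> inv h \<otimes> g \<otimes> h) v - v \<in> flag k" using act_one[OF vV] by simp
qed

text \<open>The binomial theorem for \<open>\<alpha> g\<close> as the identity plus the displacement
  \<open>\<alpha> g u - u\<close>. The operators are additive on \<open>V\<close> only, so the
  innermost application is expanded with \<open>v\<close> kept general.\<close>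

lemma funpow_binomial:
  assumes g: "g \<in> carrier G" and "v \<in> V"
  shows "(\<alpha> g ^^ m) v = (\<Sum>l\<le>m. of_nat (m choose l) * ((\<lambda>u. \<alpha> g u - u) ^^ l) v)"
  using assms(2)
proof (induction m arbitrary: v)
  case (Suc m)
  let ?d = "\<lambda>u. \<alpha> g u - u"
  have dV: "?d v \<in> V" using Suc.prems g act_V diff_V by simp
  have add: "(\<alpha> g ^^ m) (u + w) = (\<alpha> g ^^ m) u + (\<alpha> g ^^ m) w \<and> (\<alpha> g ^^ m) u \<in> V" if "u \<in> V" "w \<in> V" for u w m
    using that
  proof (induction m arbitrary: u w)
    case (Suc m)
    then show ?case using g act_add act_V by (simp del: funpow.simps add: funpow_Suc_right)
  qed simp
  have "(\<alpha> g ^^ Suc m) v = (\<alpha> g ^^ m) (v + ?d v)" by (simp del: funpow.simps add: funpow_Suc_right)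
  also have "\<dots> = (\<alpha> g ^^ m) v + (\<alpha> g ^^ m) (?d v)" using add[OF Suc.prems dV] by blast
  also have "\<dots> = (\<Sum>l\<le>m. of_nat (m choose l) * (?d ^^ l) v) + (\<Sum>l\<le>m. of_nat (m choose l) * (?d ^^ Suc l) v)"
    unfolding Suc.IH[OF Suc.prems] Suc.IH[OF dV] by (simp del: funpow.simps add: funpow_Suc_right)
  also have "(\<Sum>l\<le>m. of_nat (m choose l) * (?d ^^ l) v) = (\<Sum>l\<le>Suc m. of_nat (m choose l) * (?d ^^ l) v)"
    by (simp add: binomial_eq_0)
  also have "\<dots> = v + (\<Sum>l\<le>m. of_nat (m choose Suc l) * (?d ^^ Suc l) v)"
    by (subst sum.atMost_Suc_shift) simp
  also have "\<dots> + (\<Sum>l\<le>m. of_nat (m choose l) * (?d ^^ Suc l) v)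
      = v + (\<Sum>l\<le>m. of_nat (Suc m choose Suc l) * (?d ^^ Suc l) v)"
    by (simp add: algebra_simps sum.distrib del: funpow.simps)
  also have "\<dots> = (\<Sum>l\<le>Suc m. of_nat (Suc m choose l) * (?d ^^ l) v)"
    by (subst sum.atMost_Suc_shift) (simp del: funpow.simps add: funpow_0)
  finally show ?case .
qed simp

text \<open>In characteristic \<open>p\<close> the binomial expansion collapses:
  \<open>g ^ p - 1\<close> acts as \<open>(g - 1) ^ p\<close>, and each of the \<open>p\<close>
  factors lowers the flag by \<open>i\<close>.\<close>

lemma depth_pow:
  assumes g: "g \<in> depth_subgroup i"
  shows "g [^] p \<in> depth_subgroup (i * p)"
  unfolding depth_subgroup_def
proof (intro CollectI conjI allI ballI)
  note gc = depth_closed[OF g]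
  show "g [^] p \<in> carrier G" using gc by simp
  fix k v assume v: "v \<in> flag (k + i * p)"
  let ?d = "\<lambda>u. \<alpha> g u - u"
  have vV: "v \<in> V" by (rule flagD(1)[OF v])
  have iter: "(?d ^^ l) u \<in> flag k" if "u \<in> flag (k + i * l)" for l u
    using that
  proof (induction l arbitrary: u)
    case (Suc l)
    have "?d u \<in> flag (k + i * l)" by (rule depthD[OF g]) (use Suc.prems in \<open>simp add: ac_simps\<close>)
    from Suc.IH[OF this] show ?case by (simp del: funpow.simps add: funpow_Suc_right)
  qed simp
  have pow: "\<alpha> (g [^] m) v = (\<alpha> g ^^ m) v" for m :: nat
  proof (induction m)
    case (Suc m)
    have "g [^] Suc m = g \<otimes> g [^] m" by (rule nat_pow_Suc2[OF gc])
    then show ?case using Suc gc vV by (simp add: act_mult)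
  qed (use act_one vV in simp)
  have "(\<Sum>l\<le>p. of_nat (p choose l) * (?d ^^ l) v) = (\<Sum>l\<in>{0, p}. of_nat (p choose l) * (?d ^^ l) v)"
  proof (rule sum.mono_neutral_right)
    show "\<forall>l\<in>{..p} - {0, p}. of_nat (p choose l) * (?d ^^ l) v = 0"
    proof
      fix l assume "l \<in> {..p} - {0, p}"
      then have "p dvd (p choose l)" using Primes.dvd_choose_prime[of l p] p by auto
      then obtain c where "p choose l = p * c" by (auto elim!: dvdE)
      then show "of_nat (p choose l) * (?d ^^ l) v = 0" using char_p by simp
    qed
  qed auto
  also have "\<dots> = v + (?d ^^ p) v" using prime_gt_0_nat[OF p] by simp
  finally have "\<alpha> (g [^] p) v = v + (?d ^^ p) v" using funpow_binomial[OF gc vV, of p] pow[of p] by simp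
  then show "\<alpha> (g [^] p) v - v \<in> flag k" using iter[of v p] v by simp
qed

lemma depth_n: "\<lbrakk>g \<in> depth_subgroup n; v \<in> V\<rbrakk> \<Longrightarrow> \<alpha> g v = v"
  using depthD[of g n v 0] flag_n by simp

end

section \<open>Matrices acting on vectors over a finite field\<close>

definition vectors :: "nat \<Rightarrow> (nat \<Rightarrow> 'f::field) set" where
  "vectors n = {v. \<forall>i\<ge>n. v i = 0}"

definition mat_act :: "nat \<Rightarrow> 'f::field mat \<Rightarrow> (nat \<Rightarrow> 'f) \<Rightarrow> nat \<Rightarrow> 'f" where
  "mat_act n A v = (\<lambda>i. if i < n then \<Sum>j<n. A $$ (i, j) * v j else 0)"

lemma card_vectors: "card (vectors n :: (nat \<Rightarrow> 'f::{field,finite}) set) = CARD('f) ^ n"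
proof -
  let ?ext = "\<lambda>(w :: nat \<Rightarrow> 'f) i. if i < n then w i else 0"
  have "bij_betw (\<lambda>v. restrict v {..<n}) (vectors n) ({..<n} \<rightarrow>\<^sub>E (UNIV :: 'f set))"
  proof (rule bij_betw_byWitness[where f' = ?ext])
    show "\<forall>v\<in>vectors n. ?ext (restrict v {..<n}) = v"
    proof
      fix v :: "nat \<Rightarrow> 'f" assume "v \<in> vectors n"
      then have "?ext (restrict v {..<n}) i = v i" for i by (simp add: vectors_def)
      then show "?ext (restrict v {..<n}) = v" by (rule ext)
    qed
    show "\<forall>w\<in>{..<n} \<rightarrow>\<^sub>E UNIV. restrict (?ext w) {..<n} = w"
    proof
      fix w :: "nat \<Rightarrow> 'f" assume w: "w \<in> {..<n} \<rightarrow>\<^sub>E UNIV"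
      show "restrict (?ext w) {..<n} = w"
        by (rule extensionalityI[of _ "{..<n}"]) (use w in \<open>simp_all add: PiE_def\<close>)
    qed
    show "(\<lambda>v. restrict v {..<n}) ` vectors n \<subseteq> {..<n} \<rightarrow>\<^sub>E (UNIV :: 'f set)"
      by (intro image_subsetI) (simp add: PiE_iff)
    show "?ext ` ({..<n} \<rightarrow>\<^sub>E UNIV) \<subseteq> vectors n"
      by (intro image_subsetI) (simp add: vectors_def)
  qed
  from bij_betw_same_card[OF this] show ?thesis by (simp add: card_PiE)
qed

lemma mat_act_mult:
  assumes "A \<in> carrier_mat n n" "B \<in> carrier_mat n n"
  shows "mat_act n (A * B) v = mat_act n A (mat_act n B v)"
proof
  fix i
  show "mat_act n (A * B) v i = mat_act n A (mat_act n B v) i"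
  proof (cases "i < n")
    case True
    have "mat_act n (A * B) v i = (\<Sum>j<n. (\<Sum>k<n. A $$ (i, k) * B $$ (k, j)) * v j)"
      using True assms by (simp add: mat_act_def scalar_prod_def atLeast0LessThan)
    also have "\<dots> = (\<Sum>j<n. \<Sum>k<n. A $$ (i, k) * (B $$ (k, j) * v j))"
      by (simp add: sum_distrib_right mult.assoc)
    also have "\<dots> = (\<Sum>k<n. \<Sum>j<n. A $$ (i, k) * (B $$ (k, j) * v j))" by (rule sum.swap)
    also have "\<dots> = mat_act n A (mat_act n B v) i"
      using True by (simp add: mat_act_def sum_distrib_left)
    finally show ?thesis .
  qed (simp add: mat_act_def)
qed

lemma mat_act_one: "v \<in> vectors n \<Longrightarrow> mat_act n (1\<^sub>m n) v = v"
proof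
  fix i assume v: "v \<in> vectors n"
  have "(\<Sum>j<n. 1\<^sub>m n $$ (i, j) * v j) = (\<Sum>j<n. if j = i then v j else 0)" if "i < n"
    using that by (intro sum.cong) auto
  then show "mat_act n (1\<^sub>m n) v i = v i"
    using v by (auto simp: mat_act_def vectors_def)
qed

lemma mat_act_faithful:
  assumes "A \<in> carrier_mat n n" "\<And>v. v \<in> vectors n \<Longrightarrow> mat_act n A v = v"
  shows "A = (1\<^sub>m n :: 'f::field mat)"
proof (rule eq_matI)
  fix i j assume ij: "i < dim_row (1\<^sub>m n :: 'f mat)" "j < dim_col (1\<^sub>m n :: 'f mat)"
  let ?e = "\<lambda>k. if k = j then 1 else (0 :: 'f)"
  have "mat_act n A ?e = ?e" using ij by (intro assms(2)) (auto simp: vectors_def)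
  then have "mat_act n A ?e i = ?e i" by (rule fun_cong)
  moreover have "mat_act n A ?e i = (\<Sum>k<n. if k = j then A $$ (i, k) else 0)"
    using ij by (simp add: mat_act_def if_distrib cong: if_cong)
  ultimately show "A $$ (i, j) = 1\<^sub>m n $$ (i, j)" using ij by auto
qed (use assms in auto)

text \<open>The kernel is open and normal, so the image is a finite \<open>p\<close>-group. Its
  depth filtration is pulled back to \<open>S\<close>, where minimality of the Zassenhaus filtration
  applies; at depth \<open>n\<close> the matrix acts trivially and is therefore the
  identity.\<close>

lemma zassenhaus_subset_kernel:
  fixes S :: "('a, 'm) monoid_scheme" and T :: "'a topology"
  assumes p: "p = CARD('p::prime_card)" and pro_p: "pro_p_group p S T" and "n \<ge> 1"
    and \<rho>: "\<rho> \<in> continuous_hom S T (GL n :: 'p mod_ring mat monoid) (discrete_topology (carrier (GL n)))"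
  shows "zassenhaus p S T n \<subseteq> kernel S (GL n) \<rho>"
proof -
  let ?GL = "GL n :: 'p mod_ring mat monoid"
  let ?K = "kernel S ?GL \<rho>"
  let ?V = "vectors n :: (nat \<Rightarrow> 'p mod_ring) set"
  define \<Gamma> where "\<Gamma> = ?GL\<lparr>carrier := \<rho> ` carrier S\<rparr>"
  have prime: "prime p" using p prime_card by simp
  interpret S: compact_group S T
    using pro_p by (intro profinite_imp_compact_group) (simp add: pro_p_group_def)
  interpret GL: group ?GL by (rule GL_group)
  have \<rho>_hom: "group_hom S ?GL \<rho>"
    using \<rho> by (intro group_hom.intro group_hom_axioms.intro S.group_axioms GL_group) (auto simp: continuous_hom_def)
  have \<Gamma>_group: "group \<Gamma>"
    unfolding \<Gamma>_def by (rule GL.subgroup_imp_group[OF group_hom.img_is_subgroup[OF \<rho>_hom]])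
  have "\<rho> \<in> hom S ?GL" using \<rho> by (simp add: continuous_hom_def)
  then interpret \<Gamma>_hom: group_hom S \<Gamma> \<rho>
    by (intro group_hom.intro group_hom_axioms.intro S.group_axioms \<Gamma>_group) (auto simp: \<Gamma>_def hom_def)
  have \<Gamma>_carrier: "carrier \<Gamma> = \<rho> ` carrier S" by (simp add: \<Gamma>_def)
  have \<Gamma>_mat: "A \<in> carrier_mat n n" if "A \<in> carrier \<Gamma>" for A
    using that group_hom.hom_closed[OF \<rho>_hom] by (auto simp: \<Gamma>_carrier intro!: GL_carrier_mat)
  have \<Gamma>_simps: "A \<otimes>\<^bsub>\<Gamma>\<^esub> B = A * B" "\<one>\<^bsub>\<Gamma>\<^esub> = 1\<^sub>m n" for A B by (simp_all add: \<Gamma>_def GL_simps)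
  have kernel_eq: "kernel S \<Gamma> \<rho> = ?K" by (simp add: kernel_def \<Gamma>_def)
  note ker = kernel_continuous_hom[OF S.compact_group_axioms GL_group \<rho>]
  obtain k where k: "card (rcosets\<^bsub>S\<^esub> ?K) = p ^ k" using pro_p ker by (auto simp: pro_p_group_def)
  have "card (rcosets\<^bsub>S\<^esub> ?K) = Coset.order \<Gamma>"
  proof -
    have "bij_betw (\<lambda>X. the_elem (\<rho> ` X)) (carrier (S Mod ?K)) (carrier \<Gamma>)"
      using \<Gamma>_hom.FactGroup_iso_set \<Gamma>_carrier by (simp add: kernel_eq iso_def)
    from bij_betw_same_card[OF this] show ?thesis by (simp add: FactGroup_def Coset.order_def)
  qed
  then have order: "Coset.order \<Gamma> = p ^ k" using k by simp
  interpret M: p_group_module \<Gamma> ?V "mat_act n" p n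
  proof (intro p_group_module.intro p_group_module_axioms.intro \<Gamma>_group prime)
    show "\<exists>k. Coset.order \<Gamma> = p ^ k" using order by blast
    show "card ?V = p ^ n" using p by (simp add: card_vectors)
    have "of_nat p = (0 :: 'p mod_ring)" using p by simp
    then show "of_nat p = (0 :: nat \<Rightarrow> 'p mod_ring)" by (simp add: of_nat_fun fun_eq_iff)
    show "mat_act n (A \<otimes>\<^bsub>\<Gamma>\<^esub> B) v = mat_act n A (mat_act n B v)" if "A \<in> carrier \<Gamma>" "B \<in> carrier \<Gamma>" for A B v
      using that by (simp add: \<Gamma>_simps mat_act_mult \<Gamma>_mat)
    show "mat_act n \<one>\<^bsub>\<Gamma>\<^esub> v = v" if "v \<in> ?V" for v using that by (simp add: \<Gamma>_simps mat_act_one)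
    show "mat_act n A (u + v) = mat_act n A u + mat_act n A v" for A and u v :: "nat \<Rightarrow> 'p mod_ring"
      by (auto simp: mat_act_def fun_eq_iff algebra_simps sum.distrib)
  qed (auto simp: vectors_def mat_act_def)
  define D where "D i = {s \<in> carrier S. \<rho> s \<in> M.depth_subgroup i}" for i
  note M_sub = M.depth_subgroup
  have D_sub: "subgroup (D i) S" for i
  proof (rule S.subgroupI)
    show "D i \<noteq> {}" using subgroup.one_closed[OF M_sub[of i]] by (auto simp: D_def intro!: exI[of _ "\<one>\<^bsub>S\<^esub>"])
  qed (auto simp: D_def subgroup.m_closed[OF M_sub] subgroup.m_inv_closed[OF M_sub])
  have "zassenhaus p S T n \<subseteq> D n"
  proof (rule S.zassenhaus_least[OF prime_ge_2_nat[OF prime] D_sub])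
    \<comment> \<open>Each \<open>D i\<close> contains the open kernel, and a subgroup above an open
      neighbourhood of the identity is closed.\<close>
    show "closedin T (D i)" for i
    proof (rule S.open_subgroup_closedin[OF D_sub ker(2)])
      show "\<one>\<^bsub>S\<^esub> \<in> ?K" by (simp add: kernel_def \<Gamma>_simps GL_simps)
      show "?K \<subseteq> D i" using subgroup.one_closed[OF M_sub[of i]] by (auto simp: D_def kernel_def \<Gamma>_simps GL_simps)
    qed
    show "D (Suc 0) = carrier S" by (auto simp: D_def M.depth_1 \<Gamma>_carrier)
    show "D j \<subseteq> D i" if "i \<le> j" for i j using M.depth_antimono[OF that] by (auto simp: D_def)
    show "inv\<^bsub>S\<^esub> x \<otimes>\<^bsub>S\<^esub> inv\<^bsub>S\<^esub> y \<otimes>\<^bsub>S\<^esub> x \<otimes>\<^bsub>S\<^esub> y \<in> D (i + j)" if "x \<in> D i" "y \<in> D j" for i j x y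
      using that M.depth_comm[of "\<rho> x" i "\<rho> y" j] by (simp add: D_def)
    show "x [^]\<^bsub>S\<^esub> p \<in> D (i * p)" if "x \<in> D i" for i x
      using that M.depth_pow[of "\<rho> x" i] by (simp add: D_def \<Gamma>_hom.hom_nat_pow)
    show "n > 0" using \<open>n \<ge> 1\<close> by simp
  qed
  moreover have "D n \<subseteq> ?K"
  proof
    fix s assume s: "s \<in> D n"
    then have "\<rho> s = 1\<^sub>m n"
      using M.depth_n by (intro mat_act_faithful \<Gamma>_mat) (auto simp: D_def)
    then show "s \<in> ?K" using s by (simp add: kernel_def D_def GL_simps)
  qed
  ultimately show ?thesis by blast
qed

theorem theoremA:
  fixes S :: "('a, 'm) monoid_scheme" and T :: "'a topology" and p n :: nat
  assumes "p = CARD('p::prime_card)"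
    and "free_pro_p_group p S T"
    and "n \<ge> 1"
  shows "zassenhaus p S T n =
    (\<Inter>\<rho> \<in> continuous_hom S T (GL n :: 'p mod_ring mat monoid)
              (discrete_topology (carrier (GL n))).
       kernel S (GL n) \<rho>)"
proof -
  obtain X where X: "free_pro_p_group_on p X S T"
    using assms(2) by (auto simp: free_pro_p_group_def)
  then have pro_p: "pro_p_group p S T" by (simp add: free_pro_p_group_on_def)
  let ?Hom = "continuous_hom S T (GL n :: 'p mod_ring mat monoid) (discrete_topology (carrier (GL n)))"
  \<comment> \<open>An intersection over an empty family would be the whole type; one existing
    representation confines it to \<open>carrier S\<close>.\<close>
  obtain \<rho>\<^sub>0 where \<rho>\<^sub>0: "\<rho>\<^sub>0 \<in> ?Hom" using free_word_representation[OF assms(1) X] by blast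
  show ?thesis
  proof (intro subset_antisym INT_greatest subsetI)
    fix \<rho> s assume "\<rho> \<in> ?Hom" "s \<in> zassenhaus p S T n"
    then show "s \<in> kernel S (GL n) \<rho>"
      using zassenhaus_subset_kernel[OF assms(1) pro_p assms(3)] by blast
  next
    fix s assume s: "s \<in> (\<Inter>\<rho> \<in> ?Hom. kernel S (GL n) \<rho>)"
    then have "s \<in> carrier S" using \<rho>\<^sub>0 by (auto simp: kernel_def)
    moreover have "\<rho> s = \<one>\<^bsub>GL n\<^esub>" if "\<rho> \<in> ?Hom" for \<rho>
      using s that by (auto simp: kernel_def)
    ultimately show "s \<in> zassenhaus p S T n"
      using representation_separates[OF assms(1) X assms(3)] by blast
  qed
qed

end
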